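(* (1) Let $H_1,H_2$ be graphs with $v(H_1)\leq v(H_2)$ such that every set of $v(H_1)$ vertices of $H_2$ contains a copy of $H_1$ as a subgraph. Then $C(H_1,H_2)=\frac{v(H_1)}{v(H_2)}$. (2) Let $H$ be a graph for which there exist vertex-disjoint paths $P_{\ell_1},\ldots,P_{\ell_k}$, each with $\ell_i\geq 2$ edges, that are subgraphs of $H$ with $V(H)=\bigsqcup_{i=1}^k V(P_{\ell_i})$. Then $C(P_2,H)=\frac{3}{v(H)}$. (3) For every graph $H$, $C(K_2,H)=\nu^*(H)^{-1}$. (4) If $H_1$ is a (not necessarily spanning) subgraph of $H_2$ and $\nu^*(H_1)=\nu^*(H_2)$, then $C(H_1,H_2)=1$.
   Context: All graphs are finite and simple; $v(\cdot)$ is the number of vertices. $P_m$ denotes the path with $m$ edges and $K_2$ the single edge. $\nu^*(H)$ denotes the fractional matching number of $H$. $\operatorname{hom}(H,T)$ is the number of maps $V(H)\to V(T)$ sending every edge of $H$ to an edge of $T$, $t(H,T)=\operatorname{hom}(H,T)/v(T)^{v(H)}$, and $C(G,H)=\min\{c\in\mathbb{R}: t(G,T)\geq t(H,T)^c \text{ for all graphs } T\}$.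
   Formalization: In (1), H_1 is assumed to have no isolated vertices (the claim fails for H_1=K_2+K_1, H_2=2K_2); in (3), H is assumed to have an edge (else ν*=0); in (4), H_1 is assumed to have an edge (else the minimum does not exist); graphs have at least one vertex. *)

theory Defs
  imports
    Complex_Main
    "HOL-Library.FuncSet"
    "HOL-Library.Disjoint_Sets"
    "Graph_Theory.Pair_Digraph"
    "Graph_Theory.Digraph_Isomorphism"
begin

text \<open>
  Finite simple graphs are the symmetric loop-free pair digraphs of \<^locale>\<open>pair_graph\<close>, which
  allows the null graph. The null graph is excluded here, so that homomorphism densities into any
  graph are defined.
\<close>

definition simple_graph :: "'a pair_pre_digraph \<Rightarrow> bool" where
  "simple_graph G \<longleftrightarrow> pair_graph G \<and> pverts G \<noteq> {}"

definition nverts :: "'a pair_pre_digraph \<Rightarrow> nat" where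
  "nverts G = card (pverts G)"

text \<open>An undirected edge corresponds to two opposite arcs.\<close>

definition edges :: "'a pair_pre_digraph \<Rightarrow> 'a set set" where
  "edges G = {{x, y} | x y. (x, y) \<in> parcs G}"

text \<open>
  Isolated vertices of \<open>H\<close> change \<open>v(H)\<close> but no density: \<open>K\<^sub>2 + K\<^sub>1\<close> and \<open>2K\<^sub>2\<close> satisfy the copy condition of
  the first claim (any 3 vertices of \<open>2K\<^sub>2\<close> span an edge), yet \<open>C(K\<^sub>2 + K\<^sub>1, 2K\<^sub>2) = 1/2 \<noteq> 3/4\<close>.
  Hence that claim is about graphs \<open>H\<^sub>1\<close> without isolated vertices.
\<close>

definition no_isolated_vertex :: "'a pair_pre_digraph \<Rightarrow> bool" where
  "no_isolated_vertex G \<longleftrightarrow> (\<forall>x \<in> pverts G. \<exists>y. (x, y) \<in> parcs G)"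

definition is_subgraph :: "'a pair_pre_digraph \<Rightarrow> 'a pair_pre_digraph \<Rightarrow> bool" where
  "is_subgraph K H \<longleftrightarrow> subgraph (with_proj K) (with_proj H)"

definition isomorphic :: "'a pair_pre_digraph \<Rightarrow> 'b pair_pre_digraph \<Rightarrow> bool" where
  "isomorphic G H \<longleftrightarrow> digraph_iso (with_proj G) (with_proj H)"

definition contains_copy :: "'b pair_pre_digraph \<Rightarrow> 'b set \<Rightarrow> 'a pair_pre_digraph \<Rightarrow> bool" where
  "contains_copy H S G \<longleftrightarrow> (\<exists>K. is_subgraph K H \<and> pverts K \<subseteq> S \<and> isomorphic G K)"

definition path_graph :: "nat \<Rightarrow> nat pair_pre_digraph" where
  "path_graph m = \<lparr> pverts = {0..m},
     parcs = {(i, j). i \<le> m \<and> j \<le> m \<and> (j = Suc i \<or> i = Suc j)} \<rparr>"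

definition K2 :: "nat pair_pre_digraph" where
  "K2 = \<lparr> pverts = {0, 1}, parcs = {(0, 1), (1, 0)} \<rparr>"

definition hom_count :: "'a pair_pre_digraph \<Rightarrow> 'b pair_pre_digraph \<Rightarrow> nat" where
  "hom_count H T = card {\<phi> \<in> pverts H \<rightarrow>\<^sub>E pverts T. \<forall>(x, y) \<in> parcs H. (\<phi> x, \<phi> y) \<in> parcs T}"

definition hom_density :: "'a pair_pre_digraph \<Rightarrow> 'b pair_pre_digraph \<Rightarrow> real" where
  "hom_density H T = real (hom_count H T) / real (nverts T) ^ nverts H"

definition fractional_matching :: "'a pair_pre_digraph \<Rightarrow> ('a set \<Rightarrow> real) \<Rightarrow> bool" where
  "fractional_matching G f \<longleftrightarrow>
     (\<forall>e \<in> edges G. 0 \<le> f e) \<and> (\<forall>x \<in> pverts G. (\<Sum>e \<in> {e \<in> edges G. x \<in> e}. f e) \<le> 1)"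

definition fractional_matching_number :: "'a pair_pre_digraph \<Rightarrow> real" where
  "fractional_matching_number G = Sup {\<Sum>e \<in> edges G. f e | f. fractional_matching G f}"

text \<open>
  Target graphs may be taken to have vertices in \<^typ>\<open>nat\<close>, since every finite graph is
  isomorphic to such a graph. \<^const>\<open>powr\<close> sets \<open>0 powr c = 0\<close> for all \<open>c\<close>; when \<open>G\<close> and \<open>H\<close> both
  have an edge, this is harmless for \<open>c \<le> 0\<close>: a complete target \<open>T\<close> on sufficiently many
  vertices has \<open>0 < hom_density H T\<close> and \<open>hom_density G T < 1 \<le> hom_density H T powr c\<close>, so no such \<open>c\<close> is an element.
\<close>

definition domination_exponents :: "'a pair_pre_digraph \<Rightarrow> 'b pair_pre_digraph \<Rightarrow> real set" where
  "domination_exponents G H =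
     {c. \<forall>T :: nat pair_pre_digraph. simple_graph T \<longrightarrow> hom_density G T \<ge> hom_density H T powr c}"

text \<open>
  The equation \<open>C(G,H) = c\<close>, where \<open>C(G,H)\<close> is a minimum: it includes that the minimum is attained.
\<close>

definition has_domination_exponent ::
  "'a pair_pre_digraph \<Rightarrow> 'b pair_pre_digraph \<Rightarrow> real \<Rightarrow> bool" where
  "has_domination_exponent G H c \<longleftrightarrow>
     c \<in> domination_exponents G H \<and> (\<forall>c' \<in> domination_exponents G H. c \<le> c')"

end

theory Submission
  imports Defs "HOL-Analysis.Convex"
begin

text \<open>
  All upper bounds on the exponents come from one inequality, a form of Finner's inequality: if subgraphs
  \<open>K j\<close> of \<open>H\<close> carry nonnegative weights \<open>w j\<close> that add up to at most 1 at every vertex of \<open>H\<close>, then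
  \<open>t(H,T) \<le> (\<Prod>j. t(K j,T) powr w j)\<close>. The four claims use, respectively, all vertex subsets of size
  \<open>v(H\<^sub>1)\<close> with equal weights, the given paths, the edges weighted by a maximum fractional matching, and
  the single subgraph \<open>H\<^sub>1\<close>. For the paths, \<open>t(P\<^sub>l,T)\<^sup>3 \<le> t(P\<^sub>2,T) ^ (l + 1)\<close>: with the adjacency operator
  \<open>A\<close> and the degree function \<open>d\<close> of \<open>T\<close>, \<open>t(P\<^sub>l,T)\<close> is the inner product of \<open>d\<close> and \<open>A ^ (l - 2) d\<close>,
  and \<open>A\<close> has norm at most \<open>t(P\<^sub>2,T) powr (1/3)\<close> by Hoelder's inequality.

  The lower bounds come from one family of targets. Its simplest member, a clique padded with isolated
  vertices, shows that the exponent is at least the ratio of the vertex numbers. For the fractional matching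
  number, a minimum fractional vertex cover, half-integral by Koenig's theorem on the bipartite double cover,
  prescribes a target of edge density \<open>O(\<epsilon>)\<close> in which \<open>H\<close> has density of order at least
  \<open>\<epsilon> powr \<nu>\<^sup>*(H)\<close>.
\<close>

section \<open>Averages and Finner's inequality\<close>

definition average :: "'a set \<Rightarrow> ('a \<Rightarrow> real) \<Rightarrow> real" where
  "average A f = (\<Sum>x\<in>A. f x) / card A"

lemma average_cong: "A = B \<Longrightarrow> (\<And>x. x \<in> B \<Longrightarrow> f x = g x) \<Longrightarrow> average A f = average B g"
  by (simp add: average_def)

lemma average_const: "finite A \<Longrightarrow> A \<noteq> {} \<Longrightarrow> average A (\<lambda>_. c) = c"
  by (simp add: average_def)

lemma average_singleton: "average {a} f = f a"
  by (simp add: average_def)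

lemma average_nonneg: "(\<And>x. x \<in> A \<Longrightarrow> 0 \<le> f x) \<Longrightarrow> 0 \<le> average A f"
  by (simp add: average_def sum_nonneg)

lemma average_mono: "(\<And>x. x \<in> A \<Longrightarrow> f x \<le> g x) \<Longrightarrow> average A f \<le> average A g"
  by (simp add: average_def divide_right_mono sum_mono)

lemma average_add: "average A (\<lambda>x. f x + g x) = average A f + average A g"
  by (simp add: average_def sum.distrib add_divide_distrib)

lemma average_mult_left: "average A (\<lambda>x. c * f x) = c * average A f"
  by (simp add: average_def sum_distrib_left)

lemma average_divide: "average A (\<lambda>x. f x / c) = average A f / c"
  using average_mult_left[of A "inverse c" f] by (simp add: field_simps)

lemma average_sum: "average A (\<lambda>x. \<Sum>i\<in>I. f i x) = (\<Sum>i\<in>I. average A (f i))"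
  by (simp add: average_def sum.swap[of _ I A] sum_divide_distrib)

lemma average_swap:
  "average A (\<lambda>x. average B (f x)) = average B (\<lambda>y. average A (\<lambda>x. f x y))"
  by (simp add: average_def sum.swap[of f B A] flip: sum_divide_distrib)

lemma average_Times: "average (A \<times> B) f = average A (\<lambda>x. average B (\<lambda>y. f (x, y)))"
  by (simp add: average_def sum.cartesian_product card_cartesian_product flip: sum_divide_distrib)

lemma average_Times_mult: "average (A \<times> B) (\<lambda>(x, y). f x * g y) = average A f * average B g"
  by (simp add: average_def sum_product sum.cartesian_product card_cartesian_product)

lemma average_eq_0_iff:
  assumes "finite A" "\<And>x. x \<in> A \<Longrightarrow> 0 \<le> f x"
  shows "average A f = 0 \<longleftrightarrow> (\<forall>x\<in>A. f x = 0)"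
  using assms by (auto simp: average_def sum_nonneg_eq_0_iff)

lemma average_of_bool:
  "finite A \<Longrightarrow> average A (\<lambda>x. of_bool (P x)) = card {x \<in> A. P x} / card A"
  by (simp add: average_def Int_def)

lemma average_Cauchy_Schwarz:
  "(average A (\<lambda>x. f x * g x))\<^sup>2 \<le> average A (\<lambda>x. (f x)\<^sup>2) * average A (\<lambda>x. (g x)\<^sup>2)"
proof -
  have "(\<Sum>x\<in>A. f x * g x)\<^sup>2 / (card A)\<^sup>2 \<le> (\<Sum>x\<in>A. (f x)\<^sup>2) * (\<Sum>x\<in>A. (g x)\<^sup>2) / (card A)\<^sup>2"
    by (intro divide_right_mono Cauchy_Schwarz_ineq_sum) simp
  then show ?thesis
    by (simp add: average_def power_divide power2_eq_square)
qed

lemma weighted_arith_geom_mean: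
  fixes w y :: "'j \<Rightarrow> real"
  assumes J: "finite J" and weights: "\<And>j. j \<in> J \<Longrightarrow> 0 \<le> w j" "sum w J \<le> 1"
    and y_nonneg: "\<And>j. j \<in> J \<Longrightarrow> 0 \<le> y j"
  shows "(\<Prod>j\<in>J. y j powr w j) \<le> (\<Sum>j\<in>J. w j * y j) + (1 - sum w J)"
proof (cases "\<exists>j\<in>J. y j = 0")
  case True
  then have "(\<Prod>j\<in>J. y j powr w j) = 0"
    using J by (auto intro!: prod_zero)
  moreover have "0 \<le> (\<Sum>j\<in>J. w j * y j)"
    using weights y_nonneg by (simp add: sum_nonneg)
  ultimately show ?thesis
    using weights by simp
next
  case False
  then have y_pos: "0 < y j" if "j \<in> J" for j
    using y_nonneg[OF that] that by force
  \<comment> \<open>The missing weight is put on an additional index \<^term>\<open>None\<close>, with value 1.\<close>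
  define weight where "weight = case_option (1 - sum w J) w"
  define log_value where "log_value = case_option 0 (\<lambda>j. ln (y j))"
  define indices where "indices = insert None (Some ` J)"
  have sum_indices: "sum f indices = f None + (\<Sum>j\<in>J. f (Some j))" for f :: "'j option \<Rightarrow> real"
    using J by (simp add: indices_def sum.reindex)
  have "exp (\<Sum>i\<in>indices. weight i *\<^sub>R log_value i) \<le> (\<Sum>i\<in>indices. weight i * exp (log_value i))"
  proof (rule convex_on_sum[OF _ _ exp_convex])
    show "sum weight indices = 1"
      by (simp add: sum_indices weight_def)
  qed (use J weights in \<open>auto simp: indices_def weight_def\<close>)
  moreover have "(\<Sum>i\<in>indices. weight i * exp (log_value i)) = (\<Sum>j\<in>J. w j * y j) + (1 - sum w J)"
    unfolding sum_indices using y_pos by (simp add: weight_def log_value_def)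
  moreover have "exp (\<Sum>i\<in>indices. weight i *\<^sub>R log_value i) = (\<Prod>j\<in>J. y j powr w j)"
    unfolding sum_indices using J y_pos
    by (force simp: weight_def log_value_def exp_sum powr_def intro: prod.cong)
  ultimately show ?thesis
    by simp
qed

lemma Hoelder_average:
  fixes g :: "'j \<Rightarrow> 'x \<Rightarrow> real" and w :: "'j \<Rightarrow> real"
  assumes X: "finite X" and J: "finite J" and weights: "\<And>j. j \<in> J \<Longrightarrow> 0 \<le> w j" "sum w J \<le> 1"
    and g_nonneg: "\<And>j x. j \<in> J \<Longrightarrow> x \<in> X \<Longrightarrow> 0 \<le> g j x"
  shows "average X (\<lambda>x. \<Prod>j\<in>J. g j x powr w j) \<le> (\<Prod>j\<in>J. average X (g j) powr w j)"
proof (cases "\<exists>j\<in>J. average X (g j) = 0")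
  case True
  then have "(\<Prod>j\<in>J. g j x powr w j) = 0" if "x \<in> X" for x
    using that J by (force simp: average_eq_0_iff[OF X g_nonneg] intro!: prod_zero)
  then have "average X (\<lambda>x. \<Prod>j\<in>J. g j x powr w j) = 0"
    by (simp add: average_def)
  then show ?thesis
    by (simp add: prod_nonneg)
next
  case False
  define a where "a j = average X (g j)" for j
  have a_pos: "0 < a j" if "j \<in> J" for j
    using False that average_nonneg[of X "g j"] g_nonneg by (force simp: a_def)
  define P where "P = (\<Prod>j\<in>J. a j powr w j)"
  have "(\<Prod>j\<in>J. g j x powr w j) \<le> P * ((\<Sum>j\<in>J. w j * (g j x / a j)) + (1 - sum w J))" if "x \<in> X" for x
  proof -
    have "(\<Prod>j\<in>J. g j x powr w j) = P * (\<Prod>j\<in>J. (g j x / a j) powr w j)"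
      unfolding P_def prod.distrib[symmetric] using a_pos
      by (intro prod.cong refl) (force simp: powr_divide)
    also have "\<dots> \<le> P * ((\<Sum>j\<in>J. w j * (g j x / a j)) + (1 - sum w J))"
      using that a_pos g_nonneg weights J
      by (intro mult_left_mono weighted_arith_geom_mean) (auto simp: P_def prod_nonneg less_imp_le)
    finally show ?thesis .
  qed
  then have "average X (\<lambda>x. \<Prod>j\<in>J. g j x powr w j)
      \<le> average X (\<lambda>x. P * ((\<Sum>j\<in>J. w j * (g j x / a j)) + (1 - sum w J)))"
    by (rule average_mono)
  also have "\<dots> = P * ((\<Sum>j\<in>J. w j * (a j / a j)) + average X (\<lambda>_. 1 - sum w J))"
    by (simp only: average_mult_left average_add average_sum average_divide a_def)
  also have "\<dots> = P * (sum w J + average X (\<lambda>_. 1 - sum w J))"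
    using a_pos by (intro arg_cong2[where f = "(*)"] arg_cong2[where f = "(+)"] sum.cong) force+
  also have "\<dots> \<le> P * 1"
    using weights by (intro mult_left_mono) (auto simp: average_def P_def prod_nonneg divide_le_eq)
  finally show ?thesis
    by (simp add: P_def a_def)
qed

lemma Hoelder_average_constant_factors:
  fixes g :: "'j \<Rightarrow> 'x \<Rightarrow> real" and w :: "'j \<Rightarrow> real"
  assumes X: "finite X" and J: "finite J" "I \<subseteq> J"
    and weights: "\<And>j. j \<in> J \<Longrightarrow> 0 \<le> w j" "sum w I \<le> 1"
    and g_nonneg: "\<And>j x. j \<in> I \<Longrightarrow> x \<in> X \<Longrightarrow> 0 \<le> g j x"
    and const: "\<And>j x. j \<in> J - I \<Longrightarrow> g j x = c j"
  shows "average X (\<lambda>x. \<Prod>j\<in>J. g j x powr w j) \<le> (\<Prod>j\<in>J. average X (g j) powr w j)"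
proof (cases "X = {}")
  case True
  then show ?thesis by (simp add: average_def prod_nonneg)
next
  case False
  define C where "C = (\<Prod>j\<in>J - I. c j powr w j)"
  have C_nonneg: "0 \<le> C" by (simp add: C_def prod_nonneg)
  have average_eq: "average X (g j) = c j" if "j \<in> J - I" for j
    using False X const[OF that] by (simp add: average_def)
  have "finite I" using J by (rule rev_finite_subset)
  have "average X (\<lambda>x. \<Prod>j\<in>J. g j x powr w j) = C * average X (\<lambda>x. \<Prod>j\<in>I. g j x powr w j)"
    unfolding prod.subset_diff[OF J(2,1)] by (simp add: C_def const average_mult_left)
  also have "\<dots> \<le> C * (\<Prod>j\<in>I. average X (g j) powr w j)"
    using X \<open>finite I\<close> J(2) weights g_nonneg C_nonneg by (intro mult_left_mono Hoelder_average) auto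
  also have "\<dots> = (\<Prod>j\<in>J. average X (g j) powr w j)"
    unfolding prod.subset_diff[OF J(2,1)] by (simp add: C_def average_eq)
  finally show ?thesis .
qed

lemma average_power_le_prod_average:
  assumes X: "finite X" and J: "finite J" "J \<noteq> {}"
    and nonneg: "\<And>x. x \<in> X \<Longrightarrow> 0 \<le> F x" "\<And>j x. j \<in> J \<Longrightarrow> x \<in> X \<Longrightarrow> 0 \<le> g j x"
    and power_le: "\<And>x. x \<in> X \<Longrightarrow> F x ^ card J \<le> (\<Prod>j\<in>J. g j x)"
  shows "average X F ^ card J \<le> (\<Prod>j\<in>J. average X (g j))"
proof -
  define n where "n = card J"
  have n_pos: "0 < n" using J by (simp add: n_def card_gt_0_iff)
  have root_power: "(b powr (1 / n)) ^ n = b" "(b ^ n) powr (1 / n) = b" if "0 \<le> b" for b :: real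
    using that n_pos by (cases "b = 0"; simp add: powr_power powr_powr flip: powr_realpow)+
  have "F x \<le> (\<Prod>j\<in>J. g j x powr (1 / n))" if "x \<in> X" for x
  proof -
    have "(F x ^ n) powr (1 / n) \<le> (\<Prod>j\<in>J. g j x) powr (1 / n)"
      using power_le nonneg that by (intro powr_mono2) (auto simp: n_def)
    then show ?thesis
      using nonneg that by (simp add: root_power prod_powr_distrib)
  qed
  then have "average X F \<le> average X (\<lambda>x. \<Prod>j\<in>J. g j x powr (1 / n))"
    by (rule average_mono)
  also have "\<dots> \<le> (\<Prod>j\<in>J. average X (g j) powr (1 / n))"
    using X J nonneg n_pos by (intro Hoelder_average) (auto simp: n_def)
  finally have "average X F ^ n \<le> (\<Prod>j\<in>J. average X (g j) powr (1 / n)) ^ n"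
    using nonneg by (intro power_mono average_nonneg) auto
  also have "\<dots> = (\<Prod>j\<in>J. average X (g j))"
    unfolding prod_power_distrib using nonneg by (intro prod.cong root_power average_nonneg) auto
  finally show ?thesis
    by (simp add: n_def)
qed

lemma average_PiE_insert:
  assumes "v \<notin> V" "finite V"
  shows "average (insert v V \<rightarrow>\<^sub>E X) F = average (V \<rightarrow>\<^sub>E X) (\<lambda>\<phi>. average X (\<lambda>x. F (\<phi>(v := x))))"
proof -
  have "average (insert v V \<rightarrow>\<^sub>E X) F = average (X \<times> (V \<rightarrow>\<^sub>E X)) (\<lambda>(x, \<phi>). F (\<phi>(v := x)))"
    unfolding average_def PiE_insert_eq using inj_combinator[OF assms(1), of "\<lambda>_. X"]
    by (simp add: sum.reindex card_image case_prod_unfold comp_def)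
  then show ?thesis
    by (simp add: average_Times average_swap[of X])
qed

theorem Finner_inequality:
  fixes F :: "'j \<Rightarrow> ('v \<Rightarrow> 'x) \<Rightarrow> real" and w :: "'j \<Rightarrow> real"
  assumes "finite V" and X: "finite X" and J: "finite J"
    and w_nonneg: "\<And>j. j \<in> J \<Longrightarrow> 0 \<le> w j"
    and "\<And>v. v \<in> V \<Longrightarrow> (\<Sum>j | j \<in> J \<and> v \<in> S j. w j) \<le> 1"
    and "\<And>j \<phi>. j \<in> J \<Longrightarrow> 0 \<le> F j \<phi>"
    and "\<And>j v \<phi> x. j \<in> J \<Longrightarrow> v \<notin> S j \<Longrightarrow> F j (\<phi>(v := x)) = F j \<phi>"
  shows "average (V \<rightarrow>\<^sub>E X) (\<lambda>\<phi>. \<Prod>j\<in>J. F j \<phi> powr w j)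
    \<le> (\<Prod>j\<in>J. average (V \<rightarrow>\<^sub>E X) (F j) powr w j)"
  using assms(1,5-)
proof (induction V arbitrary: F)
  case empty
  then show ?case by (simp add: average_singleton)
next
  case (insert v V)
  define F' where "F' j \<phi> = average X (\<lambda>x. F j (\<phi>(v := x)))" for j \<phi>
  have average_fiber: "average X (\<lambda>x. \<Prod>j\<in>J. F j (\<phi>(v := x)) powr w j) \<le> (\<Prod>j\<in>J. F' j \<phi> powr w j)" for \<phi>
    unfolding F'_def
  proof (rule Hoelder_average_constant_factors[OF X J, of "{j \<in> J. v \<in> S j}" _ _ "\<lambda>j. F j \<phi>"])
    show "F j (\<phi>(v := x)) = F j \<phi>" if "j \<in> J - {j \<in> J. v \<in> S j}" for j x
      using that by (simp add: insert.prems(3))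
  qed (use w_nonneg insert.prems in auto)
  have "average (insert v V \<rightarrow>\<^sub>E X) (\<lambda>\<phi>. \<Prod>j\<in>J. F j \<phi> powr w j)
      = average (V \<rightarrow>\<^sub>E X) (\<lambda>\<phi>. average X (\<lambda>x. \<Prod>j\<in>J. F j (\<phi>(v := x)) powr w j))"
    using insert.hyps by (simp add: average_PiE_insert)
  also have "\<dots> \<le> average (V \<rightarrow>\<^sub>E X) (\<lambda>\<phi>. \<Prod>j\<in>J. F' j \<phi> powr w j)"
    by (intro average_mono average_fiber)
  also have "\<dots> \<le> (\<Prod>j\<in>J. average (V \<rightarrow>\<^sub>E X) (F' j) powr w j)"
  proof (rule insert.IH)
    show "F' j (\<phi>(u := y)) = F' j \<phi>" if "j \<in> J" "u \<notin> S j" for j u \<phi> y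
      by (cases "u = v")
        (simp_all add: F'_def fun_upd_twist[of u v] insert.prems(3)[OF that] del: fun_upd_apply)
  qed (use insert.prems in \<open>auto simp: F'_def average_nonneg\<close>)
  also have "\<dots> = (\<Prod>j\<in>J. average (insert v V \<rightarrow>\<^sub>E X) (F j) powr w j)"
    using insert.hyps by (simp add: average_PiE_insert F'_def[abs_def])
  finally show ?case .
qed

section \<open>Homomorphism densities\<close>

lemma simple_graph_iff:
  "simple_graph G \<longleftrightarrow> finite (pverts G) \<and> pverts G \<noteq> {} \<and> parcs G \<subseteq> pverts G \<times> pverts G \<and>
    sym (parcs G) \<and> irrefl (parcs G)"
proof
  assume G: "simple_graph G"
  then interpret pair_graph G by (simp add: simple_graph_def)
  show "finite (pverts G) \<and> pverts G \<noteq> {} \<and> parcs G \<subseteq> pverts G \<times> pverts G \<and>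
      sym (parcs G) \<and> irrefl (parcs G)"
    using G pair_finite_verts wellformed'
    by (auto simp: simple_graph_def intro: symI arcs_symmetric irreflI dest: no_loops')
next
  assume G: "finite (pverts G) \<and> pverts G \<noteq> {} \<and> parcs G \<subseteq> pverts G \<times> pverts G \<and>
      sym (parcs G) \<and> irrefl (parcs G)"
  then have "finite (parcs G)"
    by (meson finite_SigmaI finite_subset)
  with G have "pair_graph G"
    by unfold_locales (auto simp: symmetric_def irrefl_def)
  with G show "simple_graph G"
    by (simp add: simple_graph_def)
qed

lemma
  assumes "simple_graph G"
  shows finite_pverts: "finite (pverts G)"
    and pverts_nonempty: "pverts G \<noteq> {}"
    and nverts_pos: "0 < nverts G"
    and parcs_subset: "parcs G \<subseteq> pverts G \<times> pverts G"
    and finite_parcs: "finite (parcs G)"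
    and parcsD: "(x, y) \<in> parcs G \<Longrightarrow> x \<in> pverts G \<and> y \<in> pverts G \<and> x \<noteq> y \<and> (y, x) \<in> parcs G"
  using assms unfolding simple_graph_iff
  by (auto simp: nverts_def card_gt_0_iff irrefl_def intro: finite_subset dest: symD)

lemma pair_wf_digraph_iff: "pair_wf_digraph G \<longleftrightarrow> parcs G \<subseteq> pverts G \<times> pverts G"
  unfolding pair_wf_digraph_def by (auto simp: subset_eq)

lemma is_subgraph_iff:
  "is_subgraph K H \<longleftrightarrow> pverts K \<subseteq> pverts H \<and> parcs K \<subseteq> parcs H \<and>
    parcs K \<subseteq> pverts K \<times> pverts K \<and> parcs H \<subseteq> pverts H \<times> pverts H"
  by (auto simp: is_subgraph_def subgraph_def compatible_def wf_digraph_wp_iff pair_wf_digraph_iff)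

lemma isomorphicE:
  assumes "isomorphic G K"
  obtains f where "bij_betw f (pverts G) (pverts K)" "parcs K = map_prod f f ` parcs G"
    "parcs G \<subseteq> pverts G \<times> pverts G"
proof -
  obtain h where iso: "pre_digraph.digraph_isomorphism (with_proj G) h"
    and K_eq: "with_proj K = app_iso h (with_proj G)"
    using assms by (auto simp: isomorphic_def digraph_iso_def)
  define f where "f = iso_verts h"
  have pverts_K: "pverts K = f ` pverts G" and parcs_K: "parcs K = iso_arcs h ` parcs G"
    and tail: "fst = iso_tail h" and head: "snd = iso_head h"
    using arg_cong[OF K_eq, of verts] arg_cong[OF K_eq, of arcs]
      arg_cong[OF K_eq, of tail] arg_cong[OF K_eq, of head] by (simp_all add: f_def)
  have "iso_arcs h a = map_prod f f a" if "a \<in> parcs G" for a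
    using iso that tail head by (auto simp: pre_digraph.digraph_isomorphism_def f_def prod_eq_iff)
  then have "parcs K = map_prod f f ` parcs G"
    using parcs_K by simp
  moreover have "bij_betw f (pverts G) (pverts K)"
    using iso pverts_K by (simp add: pre_digraph.digraph_isomorphism_def bij_betw_def f_def)
  moreover have "parcs G \<subseteq> pverts G \<times> pverts G"
    using iso by (simp add: pre_digraph.digraph_isomorphism_def wf_digraph_wp_iff pair_wf_digraph_iff)
  ultimately show ?thesis using that by blast
qed

lemma isomorphic_nverts: "isomorphic G K \<Longrightarrow> nverts G = nverts K"
  by (erule isomorphicE) (simp add: nverts_def bij_betw_same_card)

definition preserves_arcs :: "'a pair_pre_digraph \<Rightarrow> 'b pair_pre_digraph \<Rightarrow> ('a \<Rightarrow> 'b) \<Rightarrow> bool" where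
  "preserves_arcs H T \<phi> \<longleftrightarrow> (\<forall>(x, y) \<in> parcs H. (\<phi> x, \<phi> y) \<in> parcs T)"

lemma preserves_arcs_fun_upd:
  assumes "parcs H \<subseteq> pverts H \<times> pverts H" "v \<notin> pverts H"
  shows "preserves_arcs H T (\<phi>(v := x)) \<longleftrightarrow> preserves_arcs H T \<phi>"
proof -
  have "a \<noteq> v \<and> b \<noteq> v" if "(a, b) \<in> parcs H" for a b
    using assms that by blast
  then show ?thesis
    by (fastforce simp: preserves_arcs_def)
qed

definition homs :: "'a pair_pre_digraph \<Rightarrow> 'b pair_pre_digraph \<Rightarrow> ('a \<Rightarrow> 'b) set" where
  "homs H T = {\<phi> \<in> pverts H \<rightarrow>\<^sub>E pverts T. preserves_arcs H T \<phi>}"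

lemma hom_count_eq_card_homs: "hom_count H T = card (homs H T)"
  by (simp add: hom_count_def homs_def preserves_arcs_def)

lemma homs_pverts: "\<phi> \<in> homs H T \<Longrightarrow> \<phi> \<in> pverts H \<rightarrow>\<^sub>E pverts T"
  by (simp add: homs_def)

lemma homs_parcs: "\<phi> \<in> homs H T \<Longrightarrow> (x, y) \<in> parcs H \<Longrightarrow> (\<phi> x, \<phi> y) \<in> parcs T"
  by (auto simp: homs_def preserves_arcs_def)

lemma finite_homs:
  assumes "finite (pverts H)" "finite (pverts T)"
  shows "finite (homs H T)"
  using assms by (simp add: homs_def finite_PiE)

lemma isomorphic_hom_density:
  assumes "isomorphic G K"
  shows "hom_density G T = hom_density K T"
proof -
  obtain f where bij: "bij_betw f (pverts G) (pverts K)" and parcs_K: "parcs K = map_prod f f ` parcs G"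
    and parcs_G: "parcs G \<subseteq> pverts G \<times> pverts G"
    using assms by (rule isomorphicE)
  define g where "g = the_inv_into (pverts G) f"
  have f_in_K: "f x \<in> pverts K" and g_f: "g (f x) = x" if "x \<in> pverts G" for x
    using that bij by (auto simp: g_def bij_betw_imp_inj_on the_inv_into_f_f dest: bij_betwE)
  have g_in_G: "g y \<in> pverts G" and f_g: "f (g y) = y" if "y \<in> pverts K" for y
    using that bij_betwE[OF bij_betw_the_inv_into[OF bij]] f_the_inv_into_f_bij_betw[OF bij]
    by (auto simp: g_def)
  have "bij_betw (\<lambda>\<phi>. restrict (\<phi> \<circ> f) (pverts G)) (homs K T) (homs G T)"
  proof (rule bij_betw_byWitness[where f' = "\<lambda>\<psi>. restrict (\<psi> \<circ> g) (pverts K)"])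
    show "\<forall>\<phi>\<in>homs K T. restrict (restrict (\<phi> \<circ> f) (pverts G) \<circ> g) (pverts K) = \<phi>"
      by (auto simp: homs_def g_in_G f_g PiE_iff intro!: extensionalityI[of _ "pverts K"])
    show "\<forall>\<psi>\<in>homs G T. restrict (restrict (\<psi> \<circ> g) (pverts K) \<circ> f) (pverts G) = \<psi>"
      by (auto simp: homs_def f_in_K g_f PiE_iff intro!: extensionalityI[of _ "pverts G"])
    show "(\<lambda>\<phi>. restrict (\<phi> \<circ> f) (pverts G)) ` homs K T \<subseteq> homs G T"
      using parcs_G f_in_K by (fastforce simp: homs_def preserves_arcs_def parcs_K PiE_iff)
    show "(\<lambda>\<psi>. restrict (\<psi> \<circ> g) (pverts K)) ` homs G T \<subseteq> homs K T"
    proof (rule image_subsetI)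
      fix \<psi> assume \<psi>: "\<psi> \<in> homs G T"
      have "(\<psi> (g (f x)), \<psi> (g (f y))) \<in> parcs T \<and> f x \<in> pverts K \<and> f y \<in> pverts K"
        if "(x, y) \<in> parcs G" for x y
        using that \<psi> parcs_G f_in_K by (auto simp: homs_def preserves_arcs_def g_f dest!: subsetD)
      then show "restrict (\<psi> \<circ> g) (pverts K) \<in> homs K T"
        using \<psi> g_in_G by (auto simp: homs_def preserves_arcs_def parcs_K)
    qed
  qed
  then have "hom_count G T = hom_count K T"
    by (simp add: hom_count_eq_card_homs bij_betw_same_card)
  then show ?thesis
    by (simp add: hom_density_def isomorphic_nverts[OF assms])
qed

lemma hom_density_nonneg: "0 \<le> hom_density H T"
  by (simp add: hom_density_def)

lemma average_PiE_superset:
  assumes V: "finite V" "S \<subseteq> V" and X: "finite X" "X \<noteq> {}"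
    and F_upd: "\<And>v \<phi> x. v \<notin> S \<Longrightarrow> F (\<phi>(v := x)) = F \<phi>"
  shows "average (V \<rightarrow>\<^sub>E X) F = average (S \<rightarrow>\<^sub>E X) F"
proof -
  have "average (S \<union> D \<rightarrow>\<^sub>E X) F = average (S \<rightarrow>\<^sub>E X) F" if "finite D" "D \<inter> S = {}" for D
    using that
  proof (induction D)
    case (insert v D)
    have "average (S \<union> insert v D \<rightarrow>\<^sub>E X) F = average (S \<union> D \<rightarrow>\<^sub>E X) (\<lambda>\<phi>. average X (\<lambda>x. F (\<phi>(v := x))))"
      using insert.hyps insert.prems V by (simp add: average_PiE_insert finite_subset)
    also have "\<dots> = average (S \<union> D \<rightarrow>\<^sub>E X) F"
      using insert.prems X by (simp add: F_upd average_const)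
    finally show ?case
      using insert by simp
  qed simp
  from this[of "V - S"] show ?thesis
    using V by (simp add: Un_absorb1 Int_commute)
qed

lemma hom_density_eq_average:
  assumes V: "finite V" "pverts K \<subseteq> V" and parcs_K: "parcs K \<subseteq> pverts K \<times> pverts K"
    and T: "simple_graph T"
  shows "hom_density K T = average (V \<rightarrow>\<^sub>E pverts T) (\<lambda>\<phi>. of_bool (preserves_arcs K T \<phi>))"
proof -
  have "finite (pverts K)" using V by (rule rev_finite_subset)
  then have "hom_density K T = average (pverts K \<rightarrow>\<^sub>E pverts T) (\<lambda>\<phi>. of_bool (preserves_arcs K T \<phi>))"
    using T by (simp add: average_of_bool finite_PiE finite_pverts card_funcsetE
        hom_density_def hom_count_eq_card_homs homs_def nverts_def)
  also have "\<dots> = average (V \<rightarrow>\<^sub>E pverts T) (\<lambda>\<phi>. of_bool (preserves_arcs K T \<phi>))"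
    using V T by (intro average_PiE_superset[symmetric])
      (simp_all add: finite_pverts pverts_nonempty preserves_arcs_fun_upd[OF parcs_K])
  finally show ?thesis .
qed

lemma hom_density_le_1:
  assumes H: "simple_graph H" and T: "simple_graph T"
  shows "hom_density H T \<le> 1"
proof -
  have "hom_density H T \<le> average (pverts H \<rightarrow>\<^sub>E pverts T) (\<lambda>_. 1)"
    unfolding hom_density_eq_average[OF finite_pverts[OF H] order_refl parcs_subset[OF H] T]
    by (rule average_mono) simp
  also have "\<dots> = 1"
    using H T by (simp add: average_const finite_PiE finite_pverts PiE_eq_empty_iff pverts_nonempty)
  finally show ?thesis .
qed

lemma hom_density_le_prod_fractional_packing:
  fixes K :: "'j \<Rightarrow> 'a pair_pre_digraph"
  assumes H: "simple_graph H" and T: "simple_graph T" and J: "finite J"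
    and subgraph: "\<And>j. j \<in> J \<Longrightarrow> is_subgraph (K j) H"
    and w_nonneg: "\<And>j. j \<in> J \<Longrightarrow> 0 \<le> w j"
    and packing: "\<And>v. v \<in> pverts H \<Longrightarrow> (\<Sum>j | j \<in> J \<and> v \<in> pverts (K j). w j) \<le> 1"
  shows "hom_density H T \<le> (\<Prod>j\<in>J. hom_density (K j) T powr w j)"
proof -
  have "hom_density H T = average (pverts H \<rightarrow>\<^sub>E pverts T) (\<lambda>\<phi>. of_bool (preserves_arcs H T \<phi>))"
    by (intro hom_density_eq_average finite_pverts parcs_subset H T order_refl)
  also have "\<dots> \<le> average (pverts H \<rightarrow>\<^sub>E pverts T) (\<lambda>\<phi>. \<Prod>j\<in>J. of_bool (preserves_arcs (K j) T \<phi>) powr w j)"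
  proof (rule average_mono)
    fix \<phi>
    have "preserves_arcs (K j) T \<phi>" if "preserves_arcs H T \<phi>" "j \<in> J" for j
      using that(1) subgraph[OF that(2)] by (auto simp: preserves_arcs_def is_subgraph_iff)
    then show "of_bool (preserves_arcs H T \<phi>) \<le> (\<Prod>j\<in>J. of_bool (preserves_arcs (K j) T \<phi>) powr w j)"
      by (cases "preserves_arcs H T \<phi>") (simp_all add: prod_nonneg)
  qed
  also have "\<dots> \<le> (\<Prod>j\<in>J. average (pverts H \<rightarrow>\<^sub>E pverts T) (\<lambda>\<phi>. of_bool (preserves_arcs (K j) T \<phi>)) powr w j)"
    using finite_pverts[OF H] finite_pverts[OF T] J w_nonneg packing
  proof (rule Finner_inequality)
    fix j v \<phi> x assume "j \<in> J" "v \<notin> pverts (K j)"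
    then show "of_bool (preserves_arcs (K j) T (\<phi>(v := x))) = (of_bool (preserves_arcs (K j) T \<phi>) :: real)"
      using subgraph[of j] by (simp add: is_subgraph_iff preserves_arcs_fun_upd)
  qed auto
  also have "\<dots> = (\<Prod>j\<in>J. hom_density (K j) T powr w j)"
    using subgraph
    by (intro prod.cong refl arg_cong2[where f = "(powr)"] hom_density_eq_average[symmetric] finite_pverts H T)
      (auto simp: is_subgraph_iff)
  finally show ?thesis .
qed

theorem hom_density_le_powr_fractional_packing:
  fixes K :: "'j \<Rightarrow> 'a pair_pre_digraph"
  assumes H: "simple_graph H" and T: "simple_graph T" and J: "finite J" "J \<noteq> {}"
    and subgraph: "\<And>j. j \<in> J \<Longrightarrow> is_subgraph (K j) H"
    and w_nonneg: "\<And>j. j \<in> J \<Longrightarrow> 0 \<le> w j"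
    and packing: "\<And>v. v \<in> pverts H \<Longrightarrow> (\<Sum>j | j \<in> J \<and> v \<in> pverts (K j). w j) \<le> 1"
    and K_le: "\<And>j. j \<in> J \<Longrightarrow> hom_density (K j) T \<le> hom_density G T powr a j"
  shows "hom_density H T \<le> hom_density G T powr (\<Sum>j\<in>J. w j * a j)"
proof -
  have "hom_density H T \<le> (\<Prod>j\<in>J. hom_density (K j) T powr w j)"
    by (rule hom_density_le_prod_fractional_packing[OF H T J(1) subgraph w_nonneg packing])
  also have "\<dots> \<le> (\<Prod>j\<in>J. hom_density G T powr (w j * a j))"
  proof (intro prod_mono conjI powr_ge_zero)
    fix j assume "j \<in> J"
    then have "hom_density (K j) T powr w j \<le> (hom_density G T powr a j) powr w j"
      using w_nonneg K_le by (intro powr_mono2) (simp_all add: hom_density_nonneg)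
    then show "hom_density (K j) T powr w j \<le> hom_density G T powr (w j * a j)"
      by (simp add: powr_powr mult.commute)
  qed
  also have "\<dots> = hom_density G T powr (\<Sum>j\<in>J. w j * a j)"
    using J by (cases "hom_density G T = 0") (simp_all add: powr_sum card_gt_0_iff)
  finally show ?thesis .
qed

section \<open>Bounding domination exponents\<close>

lemma has_domination_exponentI:
  assumes a_pos: "0 < a"
    and upper: "\<And>T :: nat pair_pre_digraph. simple_graph T \<Longrightarrow> hom_density H T \<le> hom_density G T powr a"
    and lower: "\<And>c. c \<in> domination_exponents G H \<Longrightarrow> 1 \<le> c * a"
  shows "has_domination_exponent G H (inverse a)"
  unfolding has_domination_exponent_def
proof
  show "inverse a \<in> domination_exponents G H"
    unfolding domination_exponents_def
  proof safe
    fix T :: "nat pair_pre_digraph" assume T: "simple_graph T"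
    have "hom_density H T powr inverse a \<le> (hom_density G T powr a) powr inverse a"
      using a_pos upper[OF T] by (intro powr_mono2) (auto simp: hom_density_nonneg)
    also have "\<dots> = hom_density G T"
      using a_pos hom_density_nonneg[of G T] by (simp add: powr_powr)
    finally show "hom_density H T powr inverse a \<le> hom_density G T" .
  qed
  show "\<forall>c\<in>domination_exponents G H. inverse a \<le> c"
    using a_pos lower by (simp add: inverse_eq_divide divide_le_eq)
qed

lemma powr_decay_le_imp_le:
  assumes decay_le: "\<And>m :: nat. 0 < m \<Longrightarrow> D * real m powr - b \<le> C * real m powr - a" and D_pos: "0 < D"
  shows "a \<le> b"
proof (rule ccontr)
  assume "\<not> a \<le> b"
  then have "(\<lambda>m. C * real m powr (b - a)) \<longlonglongrightarrow> C * 0"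
    by (intro tendsto_mult tendsto_const tendsto_neg_powr filterlim_real_sequentially) simp
  moreover have "D \<le> C * real m powr (b - a)" if "0 < m" for m
  proof -
    have "D = D * real m powr - b * real m powr b"
      using that by (simp add: powr_minus)
    also have "\<dots> \<le> C * real m powr - a * real m powr b"
      using decay_le[OF that] by (rule mult_right_mono) simp
    also have "\<dots> = C * real m powr (b - a)"
      by (simp add: powr_diff powr_minus divide_inverse)
    finally show ?thesis .
  qed
  ultimately have "D \<le> C * 0"
    by (intro LIMSEQ_le_const) (auto intro!: exI[of _ 1])
  with D_pos show False by simp
qed

lemma domination_exponent_lower_bound:
  fixes T :: "nat \<Rightarrow> nat pair_pre_digraph"
  assumes c_dominates: "c \<in> domination_exponents G H" and H: "simple_graph H"
    and T: "\<And>m. 0 < m \<Longrightarrow> simple_graph (T m)"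
    and G_upper: "\<And>m. 0 < m \<Longrightarrow> hom_density G (T m) \<le> C * real m powr - a"
    and H_lower: "\<And>m. 0 < m \<Longrightarrow> D * real m powr - b \<le> hom_density H (T m)"
    and pos: "0 < D" "0 < a"
  shows "a \<le> c * b"
proof -
  \<comment> \<open>A negative \<open>c\<close> is excluded along the way: \<open>hom_density H (T m) \<le> 1\<close> allows replacing \<open>c\<close> by \<open>max c 0\<close>.\<close>
  have "D powr max c 0 * real m powr - (max c 0 * b) \<le> C * real m powr - a" if m_pos: "0 < m" for m
  proof -
    have density_pos: "0 < D * real m powr - b"
      using pos m_pos by simp
    have "D powr max c 0 * real m powr - (max c 0 * b) = (D * real m powr - b) powr max c 0"
      by (simp add: powr_mult powr_powr mult.commute)
    also have "\<dots> \<le> hom_density H (T m) powr max c 0"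
      using H_lower[OF m_pos] density_pos by (intro powr_mono2) auto
    also have "\<dots> \<le> hom_density H (T m) powr c"
      using hom_density_le_1[OF H T[OF m_pos]] by (intro powr_mono') (auto simp: hom_density_nonneg)
    also have "\<dots> \<le> hom_density G (T m)"
      using c_dominates T[OF m_pos] by (simp add: domination_exponents_def)
    also have "\<dots> \<le> C * real m powr - a"
      by (rule G_upper[OF m_pos])
    finally show ?thesis .
  qed
  moreover have "0 < D powr max c 0"
    using pos by simp
  ultimately have "a \<le> max c 0 * b"
    by (rule powr_decay_le_imp_le)
  with pos show ?thesis
    by (cases "c \<le> 0") (simp_all add: max_def)
qed

section \<open>Walks and paths\<close>

locale symmetric_kernel =
  fixes X :: "'x set" and A :: "'x \<Rightarrow> 'x \<Rightarrow> real"
  assumes finite_space: "finite X"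
    and kernel_nonneg: "0 \<le> A x y"
    and kernel_le_1: "A x y \<le> 1"
    and kernel_sym: "A x y = A y x"
begin

definition operator :: "('x \<Rightarrow> real) \<Rightarrow> 'x \<Rightarrow> real" where
  "operator f x = average X (\<lambda>y. A x y * f y)"

definition degree :: "'x \<Rightarrow> real" where
  "degree = operator (\<lambda>_. 1)"

definition sq_norm :: "('x \<Rightarrow> real) \<Rightarrow> real" where
  "sq_norm f = average X (\<lambda>x. (f x)\<^sup>2)"

lemma operator_nonneg: "(\<And>x. 0 \<le> f x) \<Longrightarrow> 0 \<le> operator f x"
  by (simp add: operator_def average_nonneg kernel_nonneg)

lemma operator_power_nonneg: "(\<And>x. 0 \<le> f x) \<Longrightarrow> 0 \<le> (operator ^^ k) f x"
  by (induction k arbitrary: x) (simp_all add: operator_nonneg)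

lemma degree_nonneg: "0 \<le> degree x"
  by (simp add: degree_def operator_nonneg)

lemma sq_norm_nonneg: "0 \<le> sq_norm f"
  by (simp add: sq_norm_def average_nonneg)

lemma average_mult_operator:
  "average X (\<lambda>x. u x * operator v x) = average (X \<times> X) (\<lambda>(x, y). u x * A x y * v y)"
  by (simp add: operator_def average_Times mult.assoc flip: average_mult_left)

lemma operator_self_adjoint: "average X (\<lambda>x. u x * operator v x) = average X (\<lambda>x. operator u x * v x)"
proof -
  have "average X (\<lambda>x. u x * operator v x) = average X (\<lambda>x. average X (\<lambda>y. u x * A x y * v y))"
    by (simp add: average_mult_operator average_Times)
  also have "\<dots> = average X (\<lambda>y. average X (\<lambda>x. v y * (A y x * u x)))"
    by (subst average_swap) (simp add: kernel_sym mult_ac)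
  also have "\<dots> = average X (\<lambda>y. operator u y * v y)"
    by (simp add: operator_def average_mult_left mult.commute)
  finally show ?thesis .
qed

lemma bilinear_form_cube_le:
  assumes u_nonneg: "\<And>x. 0 \<le> u x" and v_nonneg: "\<And>x. 0 \<le> v x"
  shows "average X (\<lambda>x. u x * operator v x) ^ 3
    \<le> sq_norm u * sq_norm v * (average X (\<lambda>x. degree x * u x) * average X (\<lambda>x. degree x * v x))"
proof -
  define factors :: "('x \<times> 'x \<Rightarrow> real) list" where
    "factors = [\<lambda>(x, y). (u x)\<^sup>2 * (v y)\<^sup>2, \<lambda>(x, y). u x * A x y * 1, \<lambda>(x, y). 1 * A x y * v y]"
  have prod_factors: "(\<Prod>j<3. h (factors ! j)) = h (factors ! 0) * h (factors ! 1) * h (factors ! 2)"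
    for h :: "('x \<times> 'x \<Rightarrow> real) \<Rightarrow> real"
    by (simp add: numeral_3_eq_3 numeral_2_eq_2)
  have "average (X \<times> X) (\<lambda>(x, y). u x * A x y * v y) ^ card {..<3::nat}
      \<le> (\<Prod>j<3. average (X \<times> X) (factors ! j))"
  proof (rule average_power_le_prod_average)
    fix p :: "'x \<times> 'x"
    obtain x y where p_eq: "p = (x, y)" by (cases p)
    have "A x y ^ 3 \<le> A x y ^ 2"
      by (rule power_decreasing) (simp_all add: kernel_nonneg kernel_le_1)
    then have "(u x ^ 3 * v y ^ 3) * A x y ^ 3 \<le> (u x ^ 3 * v y ^ 3) * A x y ^ 2"
      using u_nonneg v_nonneg by (intro mult_left_mono) auto
    then show "(case p of (x, y) \<Rightarrow> u x * A x y * v y) ^ card {..<3::nat} \<le> (\<Prod>j<3. (factors ! j) p)"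
      unfolding prod_factors
      by (simp add: p_eq factors_def power_mult_distrib) (simp add: eval_nat_numeral mult_ac)
    show "0 \<le> (factors ! j) p" if "j \<in> {..<3}" for j
      using that u_nonneg v_nonneg by (auto simp: p_eq factors_def kernel_nonneg less_Suc_eq numeral_3_eq_3)
  qed (use finite_space u_nonneg v_nonneg in \<open>auto simp: kernel_nonneg lessThan_empty_iff\<close>)
  moreover have "average (X \<times> X) (factors ! 0) = sq_norm u * sq_norm v"
    by (simp add: factors_def sq_norm_def average_Times_mult)
  moreover have "average (X \<times> X) (factors ! 1) = average X (\<lambda>x. degree x * u x)"
    unfolding factors_def degree_def using average_mult_operator[of u "\<lambda>_. 1"] by (simp add: mult.commute)
  moreover have "average (X \<times> X) (factors ! 2) = average X (\<lambda>x. degree x * v x)"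
    unfolding factors_def degree_def
    using average_mult_operator[of "\<lambda>_. 1" v] operator_self_adjoint[of "\<lambda>_. 1" v] by simp
  ultimately show ?thesis
    unfolding prod_factors average_mult_operator by (simp add: mult.assoc)
qed

lemma bilinear_form_power_le:
  assumes u_nonneg: "\<And>x. 0 \<le> u x" and v_nonneg: "\<And>x. 0 \<le> v x"
  shows "average X (\<lambda>x. u x * operator v x) ^ 6 \<le> (sq_norm u * sq_norm v) ^ 3 * sq_norm degree ^ 2"
proof -
  define a b where "a = average X (\<lambda>x. degree x * u x)" and "b = average X (\<lambda>x. degree x * v x)"
  have a_bound: "a\<^sup>2 \<le> sq_norm degree * sq_norm u" and b_bound: "b\<^sup>2 \<le> sq_norm degree * sq_norm v"
    unfolding a_def b_def sq_norm_def by (rule average_Cauchy_Schwarz)+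
  have "average X (\<lambda>x. u x * operator v x) ^ 6 = (average X (\<lambda>x. u x * operator v x) ^ 3)\<^sup>2"
    by simp
  also have "\<dots> \<le> (sq_norm u * sq_norm v * (a * b))\<^sup>2"
    unfolding a_def b_def using u_nonneg v_nonneg
    by (intro power_mono bilinear_form_cube_le zero_le_power average_nonneg mult_nonneg_nonneg
        operator_nonneg) auto
  also have "\<dots> = (sq_norm u * sq_norm v)\<^sup>2 * (a\<^sup>2 * b\<^sup>2)"
    by (simp add: power_mult_distrib)
  also have "\<dots> \<le> (sq_norm u * sq_norm v)\<^sup>2 * (sq_norm degree * sq_norm u * (sq_norm degree * sq_norm v))"
    by (intro mult_left_mono mult_mono a_bound b_bound) (simp_all add: sq_norm_nonneg)
  also have "\<dots> = (sq_norm u * sq_norm v) ^ 3 * sq_norm degree ^ 2"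
    by (simp add: eval_nat_numeral mult_ac)
  finally show ?thesis .
qed

lemma sq_norm_operator_le:
  assumes f_nonneg: "\<And>x. 0 \<le> f x"
  shows "sq_norm (operator f) ^ 3 \<le> sq_norm f ^ 3 * sq_norm degree ^ 2"
proof (cases "sq_norm (operator f) = 0")
  case True
  then show ?thesis by (simp add: sq_norm_nonneg)
next
  case False
  then have pos: "0 < sq_norm (operator f) ^ 3"
    using sq_norm_nonneg[of "operator f"] by simp
  have "sq_norm (operator f) ^ 3 * sq_norm (operator f) ^ 3 = average X (\<lambda>x. operator f x * operator f x) ^ 6"
    by (simp add: sq_norm_def power2_eq_square flip: power_add)
  also have "\<dots> \<le> sq_norm (operator f) ^ 3 * (sq_norm f ^ 3 * sq_norm degree ^ 2)"
    using bilinear_form_power_le[of "operator f" f] f_nonneg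
    by (simp add: operator_nonneg power_mult_distrib mult.assoc)
  finally show ?thesis
    using pos by (rule mult_left_le_imp_le)
qed

lemma sq_norm_operator_power_le:
  assumes f_nonneg: "\<And>x. 0 \<le> f x"
  shows "sq_norm ((operator ^^ k) f) ^ 3 \<le> sq_norm f ^ 3 * sq_norm degree ^ (2 * k)"
proof (induction k)
  case (Suc k)
  have "sq_norm ((operator ^^ Suc k) f) ^ 3 \<le> sq_norm ((operator ^^ k) f) ^ 3 * sq_norm degree ^ 2"
    using sq_norm_operator_le[of "(operator ^^ k) f"] f_nonneg by (simp add: operator_power_nonneg)
  also have "\<dots> \<le> sq_norm f ^ 3 * sq_norm degree ^ (2 * k) * sq_norm degree ^ 2"
    by (intro mult_right_mono Suc.IH) (simp add: sq_norm_nonneg)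
  finally show ?case
    by (simp add: power2_eq_square mult_ac)
qed simp

definition walk_density :: "nat \<Rightarrow> real" where
  "walk_density l = average X ((operator ^^ l) (\<lambda>_. 1))"

lemma walk_density_add_2: "walk_density (l + 2) = average X (\<lambda>x. degree x * (operator ^^ l) degree x)"
proof -
  have "(operator ^^ (l + 2)) (\<lambda>_. 1) = operator ((operator ^^ l) degree)"
    by (simp add: degree_def funpow_swap1)
  then show ?thesis
    using operator_self_adjoint[of "\<lambda>_. 1" "(operator ^^ l) degree"]
    by (simp add: walk_density_def degree_def)
qed

theorem walk_density_cube_le: "walk_density (l + 2) ^ 3 \<le> walk_density 2 ^ (l + 3)"
proof -
  have walk_2: "walk_density 2 = sq_norm degree"
    using walk_density_add_2[of 0] by (simp add: sq_norm_def power2_eq_square numeral_2_eq_2)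
  have "(walk_density (l + 2) ^ 3)\<^sup>2 = ((walk_density (l + 2))\<^sup>2) ^ 3"
    by (simp flip: power_mult)
  also have "\<dots> \<le> (sq_norm degree * sq_norm ((operator ^^ l) degree)) ^ 3"
    unfolding walk_density_add_2 sq_norm_def by (intro power_mono average_Cauchy_Schwarz) simp
  also have "\<dots> \<le> sq_norm degree ^ 3 * (sq_norm degree ^ 3 * sq_norm degree ^ (2 * l))"
    unfolding power_mult_distrib using degree_nonneg
    by (intro mult_left_mono sq_norm_operator_power_le) (simp_all add: sq_norm_nonneg)
  also have "\<dots> = (walk_density 2 ^ (l + 3))\<^sup>2"
    unfolding walk_2 by (simp add: algebra_simps flip: power_add power_mult)
  finally show ?thesis
    by (rule power2_le_imp_le) (simp add: walk_2 sq_norm_nonneg)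
qed

lemma average_walk_weights:
  "average ({0..l} \<rightarrow>\<^sub>E X) (\<lambda>\<phi>. (\<Prod>i<l. A (\<phi> i) (\<phi> (Suc i))) * h (\<phi> l)) = average X ((operator ^^ l) h)"
proof (induction l arbitrary: h)
  case 0
  show ?case
    by (simp add: average_PiE_insert average_singleton)
next
  case (Suc l)
  have "average ({0..Suc l} \<rightarrow>\<^sub>E X) (\<lambda>\<phi>. (\<Prod>i<Suc l. A (\<phi> i) (\<phi> (Suc i))) * h (\<phi> (Suc l)))
      = average ({0..l} \<rightarrow>\<^sub>E X) (\<lambda>\<phi>. average X (\<lambda>x. (\<Prod>i<l. A (\<phi> i) (\<phi> (Suc i))) * (A (\<phi> l) x * h x)))"
    unfolding atLeast0_atMost_Suc by (subst average_PiE_insert) (simp_all add: mult.assoc)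
  also have "\<dots> = average ({0..l} \<rightarrow>\<^sub>E X) (\<lambda>\<phi>. (\<Prod>i<l. A (\<phi> i) (\<phi> (Suc i))) * operator h (\<phi> l))"
    by (simp add: average_mult_left operator_def)
  also have "\<dots> = average X ((operator ^^ Suc l) h)"
    by (simp add: Suc.IH funpow_swap1)
  finally show ?case .
qed

end

lemma simple_graph_path_graph: "simple_graph (path_graph l)"
  by (auto simp: simple_graph_iff path_graph_def irrefl_def intro: symI)

lemma nverts_path_graph: "nverts (path_graph l) = l + 1"
  by (simp add: nverts_def path_graph_def)

definition adjacency :: "'a pair_pre_digraph \<Rightarrow> 'a \<Rightarrow> 'a \<Rightarrow> real" where
  "adjacency T x y = of_bool ((x, y) \<in> parcs T)"

lemma symmetric_kernel_adjacency:
  assumes "simple_graph T"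
  shows "symmetric_kernel (pverts T) (adjacency T)"
  using finite_pverts[OF assms] parcsD[OF assms] by unfold_locales (auto simp: adjacency_def)

lemma hom_density_path_graph:
  assumes T: "simple_graph T"
  shows "hom_density (path_graph l) T = symmetric_kernel.walk_density (pverts T) (adjacency T) l"
proof -
  interpret symmetric_kernel "pverts T" "adjacency T"
    by (rule symmetric_kernel_adjacency[OF T])
  have preserves: "preserves_arcs (path_graph l) T \<phi> \<longleftrightarrow> (\<forall>i<l. (\<phi> i, \<phi> (Suc i)) \<in> parcs T)" for \<phi>
    using parcsD[OF T] by (fastforce simp: preserves_arcs_def path_graph_def)
  have "hom_density (path_graph l) T
      = average ({0..l} \<rightarrow>\<^sub>E pverts T) (\<lambda>\<phi>. of_bool (preserves_arcs (path_graph l) T \<phi>))"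
    using T by (intro hom_density_eq_average) (auto simp: path_graph_def)
  also have "\<dots> = average ({0..l} \<rightarrow>\<^sub>E pverts T) (\<lambda>\<phi>. (\<Prod>i<l. adjacency T (\<phi> i) (\<phi> (Suc i))) * 1)"
    unfolding preserves by (intro average_cong refl) (auto simp: adjacency_def intro: prod.neutral prod_zero)
  also have "\<dots> = walk_density l"
    unfolding walk_density_def by (rule average_walk_weights)
  finally show ?thesis .
qed

lemma power_le_power_imp_le_powr:
  fixes x y :: real
  assumes "x ^ n \<le> y ^ m" "0 \<le> x" "0 \<le> y" "0 < n" "0 < m"
  shows "x \<le> y powr (m / n)"
proof -
  have "x = (x powr n) powr (1 / n)"
    using assms by (simp add: powr_powr)
  also have "\<dots> \<le> (y powr m) powr (1 / n)"
    using assms by (intro powr_mono2) (simp_all add: powr_realpow')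
  finally show ?thesis
    by (simp add: powr_powr)
qed

theorem hom_density_path_graph_le:
  assumes T: "simple_graph T" and l: "2 \<le> l"
  shows "hom_density (path_graph l) T \<le> hom_density (path_graph 2) T powr ((l + 1) / 3)"
proof -
  interpret symmetric_kernel "pverts T" "adjacency T"
    by (rule symmetric_kernel_adjacency[OF T])
  obtain k where l_eq: "l = 2 + k"
    using l by (rule less_eqE)
  have "hom_density (path_graph l) T ^ 3 \<le> hom_density (path_graph 2) T ^ (l + 1)"
    unfolding hom_density_path_graph[OF T] using walk_density_cube_le[of k]
    by (simp add: l_eq power_add eval_nat_numeral mult_ac)
  from power_le_power_imp_le_powr[OF this] show ?thesis
    by (simp add: hom_density_nonneg add.commute)
qed

section \<open>Koenig's theorem\<close>

definition bipartite_matching :: "('a \<times> 'b) set \<Rightarrow> ('a \<times> 'b) set \<Rightarrow> bool" where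
  "bipartite_matching E M \<longleftrightarrow> M \<subseteq> E \<and> inj_on fst M \<and> inj_on snd M"

definition bipartite_cover :: "('a \<times> 'b) set \<Rightarrow> 'a set \<Rightarrow> 'b set \<Rightarrow> bool" where
  "bipartite_cover E X Y \<longleftrightarrow> finite X \<and> finite Y \<and> (\<forall>(x, y)\<in>E. x \<in> X \<or> y \<in> Y)"

definition covered_below :: "('a \<times> 'b) set \<Rightarrow> nat \<Rightarrow> bool" where
  "covered_below E t \<longleftrightarrow> (\<exists>X Y. bipartite_cover E X Y \<and> card X + card Y < t)"

lemma covered_below_converse: "covered_below (E\<inverse>) t \<longleftrightarrow> covered_below E t"
proof -
  have "bipartite_cover (E\<inverse>) Y X \<longleftrightarrow> bipartite_cover E X Y" for X Y
    by (auto simp: bipartite_cover_def)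
  then show ?thesis
    unfolding covered_below_def by (metis add.commute)
qed

lemma covered_below_merge:
  assumes "covered_below (E - {(x, y)}) t" "covered_below (E - {(x, z)}) t"
    and E: "(x, y) \<in> E" "(x, z) \<in> E" "y \<noteq> z"
  shows "covered_below E t"
proof -
  obtain X1 Y1 where cover1: "bipartite_cover (E - {(x, y)}) X1 Y1" "card X1 + card Y1 < t"
    using assms(1) by (auto simp: covered_below_def)
  obtain X2 Y2 where cover2: "bipartite_cover (E - {(x, z)}) X2 Y2" "card X2 + card Y2 < t"
    using assms(2) by (auto simp: covered_below_def)
  consider "x \<in> X1" | "x \<in> X2" | "x \<notin> X1" "x \<notin> X2" by blast
  then show ?thesis
  proof cases
    case 1
    then have "bipartite_cover E X1 Y1"
      using cover1(1) by (auto simp: bipartite_cover_def)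
    with cover1(2) show ?thesis unfolding covered_below_def by blast
  next
    case 2
    then have "bipartite_cover E X2 Y2"
      using cover2(1) by (auto simp: bipartite_cover_def)
    with cover2(2) show ?thesis unfolding covered_below_def by blast
  next
    case 3
    then have "z \<in> Y1" "y \<in> Y2"
      using cover1(1) cover2(1) E by (auto simp: bipartite_cover_def)
    then have covers: "bipartite_cover E (X1 \<inter> X2) (Y1 \<union> Y2)"
      "bipartite_cover E (insert x (X1 \<union> X2)) (Y1 \<inter> Y2)"
      using cover1(1) cover2(1) unfolding bipartite_cover_def by auto
    have "card (X1 \<inter> X2) + card (Y1 \<union> Y2) + (card (insert x (X1 \<union> X2)) + card (Y1 \<inter> Y2))
        = Suc (card X1 + card Y1 + (card X2 + card Y2))"
      using card_Un_Int[of X1 X2] card_Un_Int[of Y1 Y2] cover1(1) cover2(1) 3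
      by (simp add: bipartite_cover_def)
    with cover1(2) cover2(2) have "card (X1 \<inter> X2) + card (Y1 \<union> Y2) < t
        \<or> card (insert x (X1 \<union> X2)) + card (Y1 \<inter> Y2) < t"
      by linarith
    with covers show ?thesis unfolding covered_below_def by blast
  qed
qed

lemma critical_imp_inj_on_fst:
  assumes critical: "\<And>e. e \<in> E \<Longrightarrow> covered_below (E - {e}) t" and "\<not> covered_below E t"
  shows "inj_on fst E"
proof (rule inj_onI, rule ccontr)
  fix e f assume "e \<in> E" "f \<in> E" "fst e = fst f" "e \<noteq> f"
  then obtain x y z where E: "(x, y) \<in> E" "(x, z) \<in> E" "y \<noteq> z"
    by (cases e; cases f) auto
  from critical[OF E(1)] critical[OF E(2)] E have "covered_below E t"
    by (rule covered_below_merge)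
  with assms(2) show False ..
qed

lemma critical_imp_bipartite_matching:
  assumes critical: "\<And>e. e \<in> E \<Longrightarrow> covered_below (E - {e}) t" and not_covered: "\<not> covered_below E t"
  shows "bipartite_matching E E"
proof -
  have inj_converse: "inj_on fst (E\<inverse>)"
  proof (rule critical_imp_inj_on_fst)
    fix e assume "e \<in> E\<inverse>"
    then obtain x y where e_eq: "e = (y, x)" "(x, y) \<in> E" by auto
    then have "E\<inverse> - {e} = (E - {(x, y)})\<inverse>" by auto
    with critical[OF e_eq(2)] show "covered_below (E\<inverse> - {e}) t"
      by (simp add: covered_below_converse)
  qed (simp add: covered_below_converse not_covered)
  have "x = x'" if "(x, y) \<in> E" "(x', y) \<in> E" for x x' y
    using inj_onD[OF inj_converse, of "(y, x)" "(y, x')"] that by simp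
  then have "inj_on snd E"
    by (auto intro!: inj_onI)
  with critical_imp_inj_on_fst[OF critical not_covered] show ?thesis
    by (simp add: bipartite_matching_def)
qed

text \<open>
  Lovasz's proof: if no arc can be deleted without lowering the minimum size of a cover,
  then the relation is itself a matching, since small covers that miss only one of two adjacent arcs
  can be merged into a small cover of everything.
\<close>

theorem koenig:
  assumes "finite E"
  shows "\<exists>M X Y. bipartite_matching E M \<and> bipartite_cover E X Y \<and> card X + card Y \<le> card M"
  using assms
proof (induction E rule: finite_psubset_induct)
  case (psubset E)
  have fst_cover: "bipartite_cover E (fst ` E) {}"
    using psubset.hyps by (force simp: bipartite_cover_def)
  define t where "t = (LEAST n. \<exists>X Y. bipartite_cover E X Y \<and> card X + card Y = n)"
  have "\<exists>n X Y. bipartite_cover E X Y \<and> card X + card Y = n"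
    using fst_cover by blast
  then have "\<exists>X Y. bipartite_cover E X Y \<and> card X + card Y = t"
    unfolding t_def by (rule LeastI_ex)
  then obtain X Y where min_cover: "bipartite_cover E X Y" "card X + card Y = t"
    by blast
  have not_covered: "\<not> covered_below E t"
    unfolding t_def covered_below_def by (blast dest: not_less_Least)
  show ?case
  proof (cases "\<exists>e\<in>E. \<exists>M. bipartite_matching (E - {e}) M \<and> t \<le> card M")
    case True
    then show ?thesis
      using min_cover by (auto simp: bipartite_matching_def)
  next
    case False
    have "covered_below (E - {e}) t" if "e \<in> E" for e
    proof -
      have "E - {e} \<subset> E" using that by blast
      from psubset.IH[OF this] obtain M X Y where matching: "bipartite_matching (E - {e}) M"
        and cover: "bipartite_cover (E - {e}) X Y" "card X + card Y \<le> card M"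
        by blast
      have "card M < t"
        using False matching that by (meson not_le)
      with cover show ?thesis
        unfolding covered_below_def by (meson le_less_trans)
    qed
    then have "bipartite_matching E E"
      using not_covered by (rule critical_imp_bipartite_matching)
    moreover have "card (fst ` E) + card {} \<le> card E"
      using psubset.hyps by (simp add: card_image_le)
    ultimately show ?thesis
      using fst_cover by blast
  qed
qed

section \<open>Fractional matchings\<close>

definition fractional_vertex_cover :: "'a pair_pre_digraph \<Rightarrow> ('a \<Rightarrow> real) \<Rightarrow> bool" where
  "fractional_vertex_cover G c \<longleftrightarrow>
     (\<forall>x \<in> pverts G. 0 \<le> c x) \<and> (\<forall>(x, y) \<in> parcs G. 1 \<le> c x + c y)"

lemma finite_edges:
  assumes "simple_graph G"
  shows "finite (edges G)"
proof -
  have "edges G = (\<lambda>(x, y). {x, y}) ` parcs G" by (auto simp: edges_def)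
  then show ?thesis using finite_parcs[OF assms] by simp
qed

lemma edgesE:
  assumes "simple_graph G" "e \<in> edges G"
  obtains x y where "e = {x, y}" "(x, y) \<in> parcs G" "x \<in> pverts G" "y \<in> pverts G" "x \<noteq> y"
  using assms parcsD[OF assms(1)] by (auto simp: edges_def)

lemma fractional_matching_le_vertex_cover:
  assumes G: "simple_graph G" and matching: "fractional_matching G f" and cover: "fractional_vertex_cover G c"
  shows "(\<Sum>e\<in>edges G. f e) \<le> (\<Sum>x\<in>pverts G. c x)"
proof -
  have "f e \<le> (\<Sum>x | x \<in> pverts G \<and> x \<in> e. f e * c x)" if edge: "e \<in> edges G" for e
  proof -
    obtain x y where ends: "e = {x, y}" "(x, y) \<in> parcs G" "x \<in> pverts G" "y \<in> pverts G" "x \<noteq> y"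
      using G edge by (rule edgesE)
    have "f e * 1 \<le> f e * (c x + c y)"
      using edge ends(2) matching cover
      by (intro mult_left_mono) (auto simp: fractional_matching_def fractional_vertex_cover_def)
    moreover have "{v. v \<in> pverts G \<and> v \<in> e} = {x, y}"
      using ends by auto
    ultimately show ?thesis
      using ends(5) by (simp add: distrib_left)
  qed
  then have "(\<Sum>e\<in>edges G. f e) \<le> (\<Sum>e\<in>edges G. \<Sum>x | x \<in> pverts G \<and> x \<in> e. f e * c x)"
    by (rule sum_mono)
  also have "\<dots> = (\<Sum>x\<in>pverts G. \<Sum>e | e \<in> edges G \<and> x \<in> e. f e * c x)"
    using G by (intro sum.swap_restrict finite_edges finite_pverts)
  also have "\<dots> = (\<Sum>x\<in>pverts G. (\<Sum>e | e \<in> edges G \<and> x \<in> e. f e) * c x)"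
    by (simp add: sum_distrib_right)
  also have "\<dots> \<le> (\<Sum>x\<in>pverts G. 1 * c x)"
    using matching cover
    by (intro sum_mono mult_right_mono) (auto simp: fractional_matching_def fractional_vertex_cover_def)
  finally show ?thesis by simp
qed

lemma sum_of_bool_inj_le_1:
  assumes "inj_on g M" "finite M"
  shows "(\<Sum>m\<in>M. of_bool (g m = x)) \<le> (1 :: real)"
proof -
  have "card (M \<inter> {m. g m = x}) \<le> card {x}"
    using card_vimage_inj_on_le[OF assms(1), of "{x}"] by (simp add: vimage_def Int_commute)
  then show ?thesis
    using assms(2) by simp
qed

text \<open>
  A matching and a cover of the bipartite double cover of \<open>G\<close>, whose arcs are \<open>parcs G\<close> itself, are projected
  to \<open>G\<close> with weights 1/2.
\<close>

lemma bipartite_matching_imp_fractional_matching: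
  assumes G: "simple_graph G" and matching: "bipartite_matching (parcs G) M"
  obtains f where "fractional_matching G f" "(\<Sum>e\<in>edges G. f e) = card M / 2"
proof -
  have fin: "finite M"
    using matching finite_parcs[OF G] by (auto simp: bipartite_matching_def intro: finite_subset)
  define f where "f e = (\<Sum>(x, y)\<in>M. of_bool ({x, y} = e)) / (2 :: real)" for e
  have sum_f: "(\<Sum>e\<in>F. f e) = (\<Sum>(x, y)\<in>M. of_bool ({x, y} \<in> F)) / 2" if "finite F" for F
  proof -
    have "(\<Sum>e\<in>F. f e) = (\<Sum>m\<in>M. \<Sum>e\<in>F. case m of (x, y) \<Rightarrow> of_bool ({x, y} = e)) / 2"
      unfolding f_def sum_divide_distrib[symmetric] by (subst sum.swap) simp
    also have "\<dots> = (\<Sum>(x, y)\<in>M. of_bool ({x, y} \<in> F)) / 2"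
      using that by (intro arg_cong2[where f = "(/)"] sum.cong refl) (auto simp: of_bool_def)
    finally show ?thesis .
  qed
  have "fractional_matching G f"
    unfolding fractional_matching_def
  proof (intro conjI ballI)
    show "0 \<le> f e" for e
      by (auto simp: f_def intro!: sum_nonneg divide_nonneg_pos)
    fix x
    have "(\<Sum>e\<in>{e \<in> edges G. x \<in> e}. f e) = (\<Sum>(u, v)\<in>M. of_bool ({u, v} \<in> {e \<in> edges G. x \<in> e})) / 2"
      using finite_edges[OF G] by (intro sum_f) simp
    also have "\<dots> \<le> (\<Sum>m\<in>M. of_bool (fst m = x) + of_bool (snd m = x)) / 2"
      by (intro divide_right_mono sum_mono) auto
    also have "\<dots> \<le> (1 + 1) / 2"
      unfolding sum.distrib using matching fin
      by (intro divide_right_mono add_mono sum_of_bool_inj_le_1) (auto simp: bipartite_matching_def)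
    finally show "(\<Sum>e\<in>{e \<in> edges G. x \<in> e}. f e) \<le> 1" by simp
  qed
  moreover have "{x, y} \<in> edges G" if "(x, y) \<in> M" for x y
    using matching that unfolding bipartite_matching_def edges_def by blast
  then have "(\<Sum>(x, y)\<in>M. of_bool ({x, y} \<in> edges G)) = (\<Sum>m\<in>M. 1 :: real)"
    by (intro sum.cong) auto
  then have "(\<Sum>e\<in>edges G. f e) = card M / 2"
    by (simp add: sum_f finite_edges[OF G])
  ultimately show ?thesis using that by blast
qed

lemma bipartite_cover_imp_fractional_vertex_cover:
  assumes G: "simple_graph G" and cover: "bipartite_cover (parcs G) X Y"
  shows "fractional_vertex_cover G (\<lambda>x. real (of_bool (x \<in> X) + of_bool (x \<in> Y)) / 2)"
    and "(\<Sum>x\<in>pverts G. real (of_bool (x \<in> X) + of_bool (x \<in> Y)) / 2) \<le> (card X + card Y) / 2"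
proof -
  have "(x \<in> X \<or> y \<in> Y) \<and> (y \<in> X \<or> x \<in> Y)" if "(x, y) \<in> parcs G" for x y
    using cover parcsD[OF G that] that by (auto simp: bipartite_cover_def)
  then show "fractional_vertex_cover G (\<lambda>x. real (of_bool (x \<in> X) + of_bool (x \<in> Y)) / 2)"
    by (fastforce simp: fractional_vertex_cover_def)
  have "(\<Sum>x\<in>pverts G. real (of_bool (x \<in> X) + of_bool (x \<in> Y)) / 2)
      = (card (pverts G \<inter> X) + card (pverts G \<inter> Y)) / 2"
    using finite_pverts[OF G] by (simp add: sum.distrib flip: sum_divide_distrib)
  also have "\<dots> \<le> (card X + card Y) / 2"
    using cover by (intro divide_right_mono of_nat_mono add_mono card_mono) (auto simp: bipartite_cover_def)
  finally show "(\<Sum>x\<in>pverts G. real (of_bool (x \<in> X) + of_bool (x \<in> Y)) / 2) \<le> (card X + card Y) / 2" .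
qed

theorem fractional_matching_duality:
  assumes G: "simple_graph G"
  obtains f and k :: "'a \<Rightarrow> nat" where
    "fractional_matching G f" "(\<Sum>e\<in>edges G. f e) = fractional_matching_number G"
    "\<And>x. k x \<le> 2" "fractional_vertex_cover G (\<lambda>x. k x / 2)"
    "(\<Sum>x\<in>pverts G. k x / 2) = fractional_matching_number G"
proof -
  obtain M X Y where bip_matching: "bipartite_matching (parcs G) M"
    and bip_cover: "bipartite_cover (parcs G) X Y"
    and card_le: "card X + card Y \<le> card M"
    using koenig[OF finite_parcs[OF G]] by blast
  obtain f where f_matching: "fractional_matching G f" and sum_f: "(\<Sum>e\<in>edges G. f e) = card M / 2"
    using bipartite_matching_imp_fractional_matching[OF G bip_matching] .
  define k :: "'a \<Rightarrow> nat" where "k x = of_bool (x \<in> X) + of_bool (x \<in> Y)" for x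
  have k_cover: "fractional_vertex_cover G (\<lambda>x. k x / 2)" "(\<Sum>x\<in>pverts G. k x / 2) \<le> (card X + card Y) / 2"
    unfolding k_def using bipartite_cover_imp_fractional_vertex_cover[OF G bip_cover] .
  have weak_duality: "(\<Sum>e\<in>edges G. g e) \<le> (\<Sum>x\<in>pverts G. k x / 2)" if "fractional_matching G g" for g
    using G that k_cover(1) by (rule fractional_matching_le_vertex_cover)
  have sum_k: "(\<Sum>x\<in>pverts G. k x / 2) = (\<Sum>e\<in>edges G. f e)"
    using weak_duality[OF f_matching] k_cover(2) card_le sum_f by simp
  then have "fractional_matching_number G = (\<Sum>e\<in>edges G. f e)"
    unfolding fractional_matching_number_def using f_matching weak_duality
    by (intro cSup_eq_maximum) auto
  then show ?thesis
    using f_matching k_cover(1) sum_k by (intro that[of f k]) (auto simp: k_def)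
qed

lemma fractional_matching_number_ge_1:
  assumes G: "simple_graph G" and "edges G \<noteq> {}"
  shows "1 \<le> fractional_matching_number G"
proof -
  obtain x y where arc: "(x, y) \<in> parcs G" "x \<in> pverts G" "y \<in> pverts G" "x \<noteq> y"
    using assms by (metis edgesE ex_in_conv)
  obtain k :: "'a \<Rightarrow> nat" where k_cover: "fractional_vertex_cover G (\<lambda>x. k x / 2)"
    "(\<Sum>x\<in>pverts G. k x / 2) = fractional_matching_number G"
    using fractional_matching_duality[OF G] by metis
  have "1 \<le> (\<Sum>v\<in>{x, y}. k v / 2)"
    using k_cover(1) arc by (auto simp: fractional_vertex_cover_def)
  also have "\<dots> \<le> (\<Sum>v\<in>pverts G. k v / 2)"
    using arc finite_pverts[OF G] by (intro sum_mono2) auto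
  finally show ?thesis using k_cover(2) by simp
qed

definition complete_graph :: "'a set \<Rightarrow> 'a pair_pre_digraph" where
  "complete_graph V = \<lparr>pverts = V, parcs = {(x, y). x \<in> V \<and> y \<in> V \<and> x \<noteq> y}\<rparr>"

lemma hom_density_complete_graph_doubleton:
  assumes T: "simple_graph T" and "a \<noteq> b"
  shows "hom_density (complete_graph {a, b}) T = card (parcs T) / (nverts T)\<^sup>2"
proof -
  have preserves: "preserves_arcs (complete_graph {a, b}) T \<phi> \<longleftrightarrow> (\<phi> b, \<phi> a) \<in> parcs T" for \<phi>
    using assms(2) parcsD[OF T] by (auto simp: preserves_arcs_def complete_graph_def)
  have "hom_density (complete_graph {a, b}) T
      = average ({a, b} \<rightarrow>\<^sub>E pverts T) (\<lambda>\<phi>. of_bool ((\<phi> b, \<phi> a) \<in> parcs T))"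
    unfolding preserves[symmetric] using T by (intro hom_density_eq_average) (auto simp: complete_graph_def)
  also have "\<dots> = average (pverts T \<times> pverts T) (\<lambda>p. of_bool (p \<in> parcs T))"
    using assms(2) by (simp add: average_PiE_insert average_singleton average_Times)
  also have "\<dots> = card (parcs T) / (nverts T)\<^sup>2"
    using finite_pverts[OF T] parcs_subset[OF T]
    by (simp add: average_of_bool card_cartesian_product nverts_def power2_eq_square
        Int_def[symmetric] Int_absorb1)
  finally show ?thesis .
qed

lemma K2_eq_complete_graph: "K2 = complete_graph {0, 1}"
  by (auto simp: K2_def complete_graph_def)

lemma hom_density_K2: "simple_graph T \<Longrightarrow> hom_density K2 T = card (parcs T) / (nverts T)\<^sup>2"
  by (simp add: K2_eq_complete_graph hom_density_complete_graph_doubleton)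

theorem hom_density_le_K2_powr_fractional_matching_number:
  assumes H: "simple_graph H" and edges_nonempty: "edges H \<noteq> {}" and T: "simple_graph T"
  shows "hom_density H T \<le> hom_density K2 T powr fractional_matching_number H"
proof -
  obtain f where f_matching: "fractional_matching H f"
    and sum_f: "(\<Sum>e\<in>edges H. f e) = fractional_matching_number H"
    using fractional_matching_duality[OF H] by metis
  have "hom_density H T \<le> hom_density K2 T powr (\<Sum>e\<in>edges H. f e * 1)"
  proof (rule hom_density_le_powr_fractional_packing[OF H T finite_edges[OF H] edges_nonempty])
    fix e assume edge: "e \<in> edges H"
    obtain x y where ends: "e = {x, y}" "(x, y) \<in> parcs H" "x \<in> pverts H" "y \<in> pverts H" "x \<noteq> y"
      using H edge by (rule edgesE)
    then show "is_subgraph (complete_graph e) H"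
      using parcsD[OF H] parcs_subset[OF H] by (auto simp: is_subgraph_iff complete_graph_def)
    show "hom_density (complete_graph e) T \<le> hom_density K2 T powr 1"
      using ends(5) T by (simp add: ends(1) hom_density_complete_graph_doubleton hom_density_K2)
  qed (use f_matching in \<open>auto simp: fractional_matching_def complete_graph_def\<close>)
  then show ?thesis by (simp add: sum_f)
qed

section \<open>Threshold targets\<close>

text \<open>
  The set \<open>{..<h * m ^ a}\<close> has relative size \<open>m powr (a - d)\<close>, and sets with exponents \<open>a\<close> and \<open>s - a\<close> are
  completely joined. For \<open>d = 1\<close> and \<open>s = 0\<close> this is a clique padded with isolated vertices. For \<open>d = s = 2\<close>,
  vertices of cover weight \<open>1 - a / 2\<close> can be mapped to \<open>{..<h * m ^ a}\<close>.
\<close>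

definition threshold_graph :: "nat \<Rightarrow> nat \<Rightarrow> nat \<Rightarrow> nat \<Rightarrow> nat pair_pre_digraph" where
  "threshold_graph h d s m = \<lparr>pverts = {..<h * m ^ d},
     parcs = {(i, j). i \<noteq> j \<and> (\<exists>a\<le>s. i < h * m ^ a \<and> j < h * m ^ (s - a))}\<rparr>"

lemma nverts_threshold_graph: "nverts (threshold_graph h d s m) = h * m ^ d"
  by (simp add: nverts_def threshold_graph_def)

lemma simple_graph_threshold_graph:
  assumes pos: "0 < h" "0 < m" and s_le: "s \<le> d"
  shows "simple_graph (threshold_graph h d s m)"
proof -
  have "i < h * m ^ d" if "i < h * m ^ a" "a \<le> s" for i a
    using that(1) by (rule less_le_trans) (use that(2) pos s_le in \<open>simp add: power_increasing\<close>)
  then have "parcs (threshold_graph h d s m)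
      \<subseteq> pverts (threshold_graph h d s m) \<times> pverts (threshold_graph h d s m)"
    by (fastforce simp: threshold_graph_def)
  moreover have "sym (parcs (threshold_graph h d s m))"
  proof (rule symI)
    fix i j assume "(i, j) \<in> parcs (threshold_graph h d s m)"
    then obtain a where "i \<noteq> j" "a \<le> s" "i < h * m ^ a" "j < h * m ^ (s - a)"
      by (auto simp: threshold_graph_def)
    then show "(j, i) \<in> parcs (threshold_graph h d s m)"
      by (auto simp: threshold_graph_def intro!: exI[of _ "s - a"])
  qed
  ultimately show ?thesis
    using pos by (auto simp: simple_graph_iff threshold_graph_def irrefl_def lessThan_empty_iff)
qed

lemma hom_density_K2_threshold_graph_le:
  assumes pos: "0 < h" "0 < m" and s_le: "s \<le> d"
  shows "hom_density K2 (threshold_graph h d s m) \<le> real (s + 1) * real m powr - (2 * real d - real s)"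
proof -
  have "parcs (threshold_graph h d s m) \<subseteq> (\<Union>a\<in>{..s}. {..<h * m ^ a} \<times> {..<h * m ^ (s - a)})"
    by (auto simp: threshold_graph_def)
  then have "card (parcs (threshold_graph h d s m))
      \<le> card (\<Union>a\<in>{..s}. {..<h * m ^ a} \<times> {..<h * m ^ (s - a)})"
    by (intro card_mono) auto
  also have "\<dots> \<le> (\<Sum>a\<in>{..s}. card ({..<h * m ^ a} \<times> {..<h * m ^ (s - a)}))"
    by (intro card_UN_le) auto
  also have "\<dots> = (\<Sum>a\<in>{..s}. h\<^sup>2 * m ^ s)"
    by (intro sum.cong refl) (simp add: card_cartesian_product power2_eq_square mult_ac flip: power_add)
  finally have "real (card (parcs (threshold_graph h d s m))) \<le> real ((s + 1) * (h\<^sup>2 * m ^ s))"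
    by (intro of_nat_mono) simp
  then have "hom_density K2 (threshold_graph h d s m) \<le> real ((s + 1) * (h\<^sup>2 * m ^ s)) / (real (h * m ^ d))\<^sup>2"
    unfolding hom_density_K2[OF simple_graph_threshold_graph[OF assms]] nverts_threshold_graph of_nat_power
    by (rule divide_right_mono) simp
  also have "\<dots> = real (s + 1) * real m powr - (2 * real d - real s)"
  proof -
    have "real m powr (2 * real d) = (real m ^ d)\<^sup>2"
      using pos powr_realpow[of "real m" "d * 2"] by (simp add: power_mult mult.commute)
    then show ?thesis
      using pos by (simp add: powr_diff powr_realpow power_mult_distrib add_divide_distrib distrib_right)
  qed
  finally show ?thesis .
qed

lemma hom_density_threshold_graph_0_le:
  assumes G: "finite (pverts G)" "no_isolated_vertex G" and pos: "0 < h" "0 < m"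
  shows "hom_density G (threshold_graph h d 0 m) \<le> real m powr - (real d * real (nverts G))"
proof -
  have "homs G (threshold_graph h d 0 m) \<subseteq> pverts G \<rightarrow>\<^sub>E {..<h}"
  proof (rule subsetI)
    fix \<phi> assume \<phi>: "\<phi> \<in> homs G (threshold_graph h d 0 m)"
    have "\<phi> x < h" if "x \<in> pverts G" for x
    proof -
      obtain y where "(x, y) \<in> parcs G" using G(2) \<open>x \<in> pverts G\<close> by (auto simp: no_isolated_vertex_def)
      then have "(\<phi> x, \<phi> y) \<in> parcs (threshold_graph h d 0 m)"
        using \<phi> by (rule homs_parcs[rotated])
      then show ?thesis by (simp add: threshold_graph_def)
    qed
    then show "\<phi> \<in> pverts G \<rightarrow>\<^sub>E {..<h}"
      using homs_pverts[OF \<phi>] by (auto simp: PiE_iff)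
  qed
  then have "hom_count G (threshold_graph h d 0 m) \<le> card (pverts G \<rightarrow>\<^sub>E {..<h})"
    unfolding hom_count_eq_card_homs using G by (intro card_mono finite_PiE) auto
  then have "real (hom_count G (threshold_graph h d 0 m)) \<le> real (h ^ nverts G)"
    using G by (simp add: card_funcsetE nverts_def)
  then have "hom_density G (threshold_graph h d 0 m) \<le> real (h ^ nverts G) / real (h * m ^ d) ^ nverts G"
    unfolding hom_density_def nverts_threshold_graph by (rule divide_right_mono) simp
  also have "\<dots> = real m powr - (real d * real (nverts G))"
    using pos powr_realpow[of "real m" "d * nverts G"]
    by (simp add: power_mult_distrib powr_minus inverse_eq_divide flip: power_mult)
  finally show ?thesis .
qed

definition arith_progression :: "nat \<Rightarrow> nat \<Rightarrow> nat \<Rightarrow> nat set" where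
  "arith_progression h r n = (\<lambda>q. r + h * q) ` {..<n}"

lemma card_arith_progression: "0 < h \<Longrightarrow> card (arith_progression h r n) = n"
  unfolding arith_progression_def by (subst card_image) (auto simp: inj_on_def)

lemma arith_progression_mod: "r < h \<Longrightarrow> i \<in> arith_progression h r n \<Longrightarrow> i mod h = r"
  by (auto simp: arith_progression_def)

lemma arith_progression_less:
  assumes "r < h" "i \<in> arith_progression h r n"
  shows "i < h * n"
proof -
  obtain q where i_eq: "i = r + h * q" "q < n"
    using assms(2) by (auto simp: arith_progression_def)
  then have "i < h * Suc q" using assms(1) by simp
  also have "\<dots> \<le> h * n" using i_eq(2) by (intro mult_le_mono2) simp
  finally show ?thesis .
qed

text \<open>
  Mapping the vertices of \<open>H\<close> into distinct residue classes modulo \<open>v(H)\<close> keeps the images of adjacent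
  vertices apart.
\<close>

lemma hom_count_threshold_graph_ge:
  assumes H: "simple_graph H" and m_pos: "0 < m" and a_le: "\<And>x. x \<in> pverts H \<Longrightarrow> a x \<le> d"
    and arcs: "\<And>x y. (x, y) \<in> parcs H \<Longrightarrow> a x + a y \<le> s"
  shows "m ^ (\<Sum>x\<in>pverts H. a x) \<le> hom_count H (threshold_graph (nverts H) d s m)"
proof -
  define h where "h = nverts H"
  note fin = finite_pverts[OF H]
  obtain r where "bij_betw r (pverts H) {0..<h}"
    using ex_bij_betw_finite_nat[OF fin] unfolding h_def nverts_def by blast
  then have r_numbering: "inj_on r (pverts H)" "\<And>x. x \<in> pverts H \<Longrightarrow> r x < h"
    by (auto simp: bij_betw_def)
  define B where "B x = arith_progression h (r x) (m ^ a x)" for x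
  have "(\<Pi>\<^sub>E x\<in>pverts H. B x) \<subseteq> homs H (threshold_graph h d s m)"
  proof (rule subsetI)
    fix \<phi> assume \<phi>: "\<phi> \<in> (\<Pi>\<^sub>E x\<in>pverts H. B x)"
    have phi_less: "\<phi> x < h * m ^ n" if "x \<in> pverts H" "a x \<le> n" for x n
    proof -
      have "\<phi> x < h * m ^ a x"
        using r_numbering(2)[OF that(1)] PiE_mem[OF \<phi> that(1)] unfolding B_def by (rule arith_progression_less)
      also have "\<dots> \<le> h * m ^ n"
        using that(2) m_pos by (simp add: power_increasing)
      finally show ?thesis .
    qed
    have phi_mod: "\<phi> x mod h = r x" if "x \<in> pverts H" for x
      using r_numbering(2)[OF that] PiE_mem[OF \<phi> that] unfolding B_def by (rule arith_progression_mod)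
    have "(\<phi> x, \<phi> y) \<in> parcs (threshold_graph h d s m)" if arc: "(x, y) \<in> parcs H" for x y
    proof -
      have ends: "x \<in> pverts H" "y \<in> pverts H" "x \<noteq> y" using parcsD[OF H arc] by auto
      have "\<phi> x \<noteq> \<phi> y" using ends r_numbering(1) phi_mod by (metis inj_onD)
      moreover have "a x \<le> s" "a y \<le> s - a x" using arcs[OF arc] by auto
      ultimately show ?thesis using phi_less ends by (auto simp: threshold_graph_def)
    qed
    then show "\<phi> \<in> homs H (threshold_graph h d s m)"
      using \<phi> phi_less a_le by (auto simp: homs_def preserves_arcs_def threshold_graph_def PiE_iff)
  qed
  then have "card (\<Pi>\<^sub>E x\<in>pverts H. B x) \<le> hom_count H (threshold_graph h d s m)"
    unfolding hom_count_eq_card_homs by (intro card_mono finite_homs fin) (simp add: threshold_graph_def)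
  then show ?thesis
    using fin nverts_pos[OF H] by (simp add: card_PiE power_sum B_def card_arith_progression h_def)
qed

lemma hom_density_threshold_graph_ge:
  assumes H: "simple_graph H" and m_pos: "0 < m" and a_le: "\<And>x. x \<in> pverts H \<Longrightarrow> a x \<le> d"
    and arcs: "\<And>x y. (x, y) \<in> parcs H \<Longrightarrow> a x + a y \<le> s"
  shows "(1 / real (nverts H) ^ nverts H)
      * real m powr - (real d * real (nverts H) - (\<Sum>x\<in>pverts H. real (a x)))
    \<le> hom_density H (threshold_graph (nverts H) d s m)"
proof -
  define h where "h = nverts H"
  have "real m powr (real d * real h) = (real m ^ d) ^ h"
    using powr_realpow[of "real m" "d * h"] m_pos by (simp add: power_mult)
  then have "(1 / real h ^ h) * real m powr - (real d * real h - (\<Sum>x\<in>pverts H. real (a x)))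
      = real m ^ (\<Sum>x\<in>pverts H. a x) / real (h * m ^ d) ^ h"
    using m_pos powr_realpow[of "real m" "\<Sum>x\<in>pverts H. a x"] by (simp add: powr_diff power_mult_distrib)
  also have "\<dots> \<le> real (hom_count H (threshold_graph h d s m)) / real (h * m ^ d) ^ h"
    using hom_count_threshold_graph_ge[OF assms]
    by (intro divide_right_mono) (simp_all add: h_def flip: of_nat_power)
  finally show ?thesis
    by (simp add: hom_density_def nverts_threshold_graph h_def)
qed

lemma domination_exponent_ge_nverts_ratio:
  assumes G: "simple_graph G" "no_isolated_vertex G" and H: "simple_graph H"
    and c_dominates: "c \<in> domination_exponents G H"
  shows "real (nverts G) \<le> c * real (nverts H)"
proof (rule domination_exponent_lower_bound[OF c_dominates H])
  fix m :: nat assume m_pos: "0 < m"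
  show "simple_graph (threshold_graph (nverts H) 1 0 m)"
    using nverts_pos[OF H] m_pos by (rule simple_graph_threshold_graph) simp
  show "hom_density G (threshold_graph (nverts H) 1 0 m) \<le> 1 * real m powr - real (nverts G)"
    using hom_density_threshold_graph_0_le[OF finite_pverts[OF G(1)] G(2) nverts_pos[OF H] m_pos, of 1] by simp
  show "(1 / real (nverts H) ^ nverts H) * real m powr - real (nverts H)
      \<le> hom_density H (threshold_graph (nverts H) 1 0 m)"
    using hom_density_threshold_graph_ge[OF H m_pos, of "\<lambda>_. 0" 1 0] by simp
qed (use nverts_pos[OF G(1)] nverts_pos[OF H] in auto)

lemma domination_exponent_ge_matching_ratio:
  assumes a_pos: "0 < a"
    and G_le: "\<And>T :: nat pair_pre_digraph. simple_graph T \<Longrightarrow> hom_density G T \<le> hom_density K2 T powr a"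
    and H: "simple_graph H" and c_dominates: "c \<in> domination_exponents G H"
  shows "a \<le> c * fractional_matching_number H"
proof -
  obtain k :: "'b \<Rightarrow> nat" where k_cover: "\<And>x. k x \<le> 2" "fractional_vertex_cover H (\<lambda>x. k x / 2)"
    "(\<Sum>x\<in>pverts H. k x / 2) = fractional_matching_number H"
    using fractional_matching_duality[OF H] by metis
  have sum_exponents: "(\<Sum>x\<in>pverts H. real (2 - k x))
      = 2 * real (nverts H) - 2 * fractional_matching_number H"
    using k_cover(1) by (simp add: of_nat_diff sum_subtractf nverts_def sum_distrib_left flip: k_cover(3))
  have "2 * a \<le> c * (2 * fractional_matching_number H)"
  proof (rule domination_exponent_lower_bound[OF c_dominates H])
    fix m :: nat assume m_pos: "0 < m"
    show target_simple: "simple_graph (threshold_graph (nverts H) 2 2 m)"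
      using nverts_pos[OF H] m_pos by (rule simple_graph_threshold_graph) simp
    have "hom_density G (threshold_graph (nverts H) 2 2 m)
        \<le> hom_density K2 (threshold_graph (nverts H) 2 2 m) powr a"
      using target_simple by (rule G_le)
    also have "\<dots> \<le> (3 * real m powr - 2) powr a"
      using hom_density_K2_threshold_graph_le[OF nverts_pos[OF H] m_pos, of 2 2] a_pos
      by (intro powr_mono2) (auto simp: hom_density_nonneg)
    also have "\<dots> = 3 powr a * real m powr - (2 * a)"
      by (simp add: powr_mult powr_powr)
    finally show "hom_density G (threshold_graph (nverts H) 2 2 m) \<le> 3 powr a * real m powr - (2 * a)" .
    have "(2 - k x) + (2 - k y) \<le> 2" if "(x, y) \<in> parcs H" for x y
      using k_cover(1)[of x] k_cover(1)[of y] k_cover(2) that by (fastforce simp: fractional_vertex_cover_def)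
    then show "(1 / real (nverts H) ^ nverts H) * real m powr - (2 * fractional_matching_number H)
        \<le> hom_density H (threshold_graph (nverts H) 2 2 m)"
      using hom_density_threshold_graph_ge[OF H m_pos, of "\<lambda>x. 2 - k x" 2 2]
      by (simp add: sum_exponents)
  qed (use nverts_pos[OF H] a_pos in auto)
  then show ?thesis by simp
qed

section \<open>Domination exponents\<close>

lemma card_subsets_containing:
  assumes V: "finite V" "v \<in> V" and k_pos: "0 < k"
  shows "card {S. S \<subseteq> V \<and> card S = k \<and> v \<in> S} = (card V - 1) choose (k - 1)"
proof -
  have "bij_betw (insert v) {S. S \<subseteq> V - {v} \<and> card S = k - 1} {S. S \<subseteq> V \<and> card S = k \<and> v \<in> S}"
  proof (rule bij_betw_byWitness[where f' = "\<lambda>S. S - {v}"])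
    show "insert v ` {S. S \<subseteq> V - {v} \<and> card S = k - 1} \<subseteq> {S. S \<subseteq> V \<and> card S = k \<and> v \<in> S}"
    proof (rule image_subsetI)
      fix S assume S: "S \<in> {S. S \<subseteq> V - {v} \<and> card S = k - 1}"
      then have "finite S" "v \<notin> S" using V by (auto intro: finite_subset)
      then show "insert v S \<in> {S. S \<subseteq> V \<and> card S = k \<and> v \<in> S}" using S V k_pos by auto
    qed
  qed auto
  then have "card {S. S \<subseteq> V \<and> card S = k \<and> v \<in> S} = card {S. S \<subseteq> V - {v} \<and> card S = k - 1}"
    by (simp add: bij_betw_same_card)
  also have "\<dots> = (card V - 1) choose (k - 1)"
    using V by (simp add: n_subsets)
  finally show ?thesis .
qed

lemma binomial_minus1_ratio:
  assumes "0 < k" "k \<le> n"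
  shows "real (n choose k) / real ((n - 1) choose (k - 1)) = real n / real k"
proof -
  have "real k * real (n choose k) = real n * real ((n - 1) choose (k - 1))"
    using times_binomial_minus1_eq[OF assms(1), of n] by (simp flip: of_nat_mult)
  moreover have "0 < (n - 1) choose (k - 1)"
    using assms by simp
  ultimately show ?thesis
    using assms(1) by (simp add: field_simps)
qed

lemma contains_copy_spanning:
  assumes "contains_copy H S G" "finite S" "card S = nverts G"
  obtains K where "is_subgraph K H" "pverts K = S" "isomorphic G K"
proof -
  obtain K where K: "is_subgraph K H" "pverts K \<subseteq> S" "isomorphic G K"
    using assms(1) by (auto simp: contains_copy_def)
  moreover have "pverts K = S"
    using K(2) assms(2,3) isomorphic_nverts[OF K(3)] by (simp add: card_subset_eq nverts_def)
  ultimately show ?thesis using that by blast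
qed

lemma hom_density_le_powr_of_copies:
  assumes G: "simple_graph G" and H: "simple_graph H" and nverts_le: "nverts G \<le> nverts H"
    and copies: "\<And>S. S \<subseteq> pverts H \<Longrightarrow> card S = nverts G \<Longrightarrow> contains_copy H S G"
    and T: "simple_graph T"
  shows "hom_density H T \<le> hom_density G T powr (real (nverts H) / real (nverts G))"
proof -
  define n k where "n = nverts H" and "k = nverts G"
  have k_bounds: "0 < k" "k \<le> n" using nverts_pos[OF G] nverts_le by (simp_all add: n_def k_def)
  define J where "J = {S. S \<subseteq> pverts H \<and> card S = k}"
  have card_J: "card J = n choose k"
    using finite_pverts[OF H] by (simp add: J_def n_subsets n_def nverts_def)
  have "\<exists>K. is_subgraph K H \<and> pverts K = S \<and> isomorphic G K" if "S \<in> J" for S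
  proof -
    have "contains_copy H S G" "finite S" "card S = nverts G"
      using that copies finite_pverts[OF H] by (auto simp: J_def k_def intro: finite_subset)
    then show ?thesis by (metis contains_copy_spanning)
  qed
  then obtain K where K_copy: "\<And>S. S \<in> J \<Longrightarrow> is_subgraph (K S) H" "\<And>S. S \<in> J \<Longrightarrow> pverts (K S) = S"
    "\<And>S. S \<in> J \<Longrightarrow> isomorphic G (K S)"
    by metis
  define b where "b = (n - 1) choose (k - 1)"
  have b_pos: "0 < b" using k_bounds by (simp add: b_def)
  have "hom_density H T \<le> hom_density G T powr (\<Sum>S\<in>J. 1 / real b * 1)"
  proof (rule hom_density_le_powr_fractional_packing[OF H T _ _ K_copy(1)])
    have "0 < card J" using k_bounds by (simp add: card_J)
    then show "finite J" "J \<noteq> {}" by (auto simp: card_gt_0_iff)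
    show "hom_density (K S) T \<le> hom_density G T powr 1" if "S \<in> J" for S
      using isomorphic_hom_density[OF K_copy(3)[OF that], of T] by (simp add: hom_density_nonneg)
    fix v assume "v \<in> pverts H"
    moreover have "{S. S \<in> J \<and> v \<in> pverts (K S)} = {S. S \<subseteq> pverts H \<and> card S = k \<and> v \<in> S}"
      using K_copy(2) by (auto simp: J_def)
    ultimately have "card {S. S \<in> J \<and> v \<in> pverts (K S)} = b"
      using card_subsets_containing[OF finite_pverts[OF H] _ k_bounds(1)] by (simp add: b_def n_def nverts_def)
    then show "(\<Sum>S | S \<in> J \<and> v \<in> pverts (K S). 1 / real b) \<le> 1"
      using b_pos by simp
  qed auto
  also have "(\<Sum>S\<in>J. 1 / real b * 1) = real n / real k"
    using binomial_minus1_ratio[OF k_bounds] by (simp add: card_J b_def)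
  finally show ?thesis by (simp add: n_def k_def)
qed

theorem domination_exponent_copies:
  assumes G: "simple_graph G" "no_isolated_vertex G" and H: "simple_graph H"
    and nverts_le: "nverts G \<le> nverts H"
    and copies: "\<And>S. S \<subseteq> pverts H \<Longrightarrow> card S = nverts G \<Longrightarrow> contains_copy H S G"
  shows "has_domination_exponent G H (real (nverts G) / real (nverts H))"
proof -
  have pos: "0 < real (nverts H) / real (nverts G)"
    using nverts_pos[OF G(1)] nverts_pos[OF H] by simp
  have "1 \<le> c * (real (nverts H) / real (nverts G))" if "c \<in> domination_exponents G H" for c
    using domination_exponent_ge_nverts_ratio[OF G H that] nverts_pos[OF G(1)] by (simp add: le_divide_eq)
  from has_domination_exponentI[OF pos hom_density_le_powr_of_copies[OF G(1) H nverts_le copies] this]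
  show ?thesis by simp
qed

lemma no_isolated_vertex_path_graph:
  assumes "0 < l"
  shows "no_isolated_vertex (path_graph l)"
  unfolding no_isolated_vertex_def
proof
  fix x assume "x \<in> pverts (path_graph l)"
  then have "(x, if x = 0 then 1 else x - 1) \<in> parcs (path_graph l)"
    using assms by (auto simp: path_graph_def)
  then show "\<exists>y. (x, y) \<in> parcs (path_graph l)" by blast
qed

lemma hom_density_le_powr_of_path_partition:
  assumes H: "simple_graph H" and I: "finite I"
    and P: "\<And>i. i \<in> I \<Longrightarrow> 2 \<le> l i" "\<And>i. i \<in> I \<Longrightarrow> is_subgraph (P i) H"
      "\<And>i. i \<in> I \<Longrightarrow> isomorphic (path_graph (l i)) (P i)"
    and disj: "disjoint_family_on (\<lambda>i. pverts (P i)) I" and pverts_H: "pverts H = (\<Union>i\<in>I. pverts (P i))"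
    and T: "simple_graph T"
  shows "hom_density H T \<le> hom_density (path_graph 2) T powr (real (nverts H) / 3)"
proof -
  have card_P: "card (pverts (P i)) = l i + 1" if "i \<in> I" for i
    using isomorphic_nverts[OF P(3)[OF that]] unfolding nverts_path_graph by (simp add: nverts_def)
  have "nverts H = (\<Sum>i\<in>I. card (pverts (P i)))"
    unfolding nverts_def pverts_H using I disj card_P
    by (intro card_UN_disjoint) (auto simp: disjoint_family_on_def intro: card_ge_0_finite)
  then have nverts_H: "real (nverts H) = (\<Sum>i\<in>I. real (l i) + 1)"
    using card_P by (simp add: add.commute)
  have "hom_density H T \<le> hom_density (path_graph 2) T powr (\<Sum>i\<in>I. 1 * ((real (l i) + 1) / 3))"
  proof (rule hom_density_le_powr_fractional_packing[OF H T I _ P(2)])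
    show "I \<noteq> {}"
      using pverts_nonempty[OF H] pverts_H by auto
    show "hom_density (P i) T \<le> hom_density (path_graph 2) T powr ((real (l i) + 1) / 3)" if "i \<in> I" for i
      using hom_density_path_graph_le[OF T P(1)[OF that]] isomorphic_hom_density[OF P(3)[OF that], of T]
      by simp
    fix v assume "v \<in> pverts H"
    then obtain i where "i \<in> I" "v \<in> pverts (P i)" using pverts_H by auto
    then have "{j. j \<in> I \<and> v \<in> pverts (P j)} = {i}"
      using disj by (fastforce simp: disjoint_family_on_def)
    then show "(\<Sum>j | j \<in> I \<and> v \<in> pverts (P j). 1 :: real) \<le> 1" by simp
  qed auto
  then show ?thesis
    by (simp add: nverts_H sum_divide_distrib)
qed

theorem domination_exponent_path_partition:
  assumes H: "simple_graph H" and I: "finite I"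
    and P: "\<And>i. i \<in> I \<Longrightarrow> 2 \<le> l i" "\<And>i. i \<in> I \<Longrightarrow> is_subgraph (P i) H"
      "\<And>i. i \<in> I \<Longrightarrow> isomorphic (path_graph (l i)) (P i)"
    and disj: "disjoint_family_on (\<lambda>i. pverts (P i)) I" and pverts_H: "pverts H = (\<Union>i\<in>I. pverts (P i))"
  shows "has_domination_exponent (path_graph 2) H (3 / real (nverts H))"
proof -
  have pos: "0 < real (nverts H) / 3"
    using nverts_pos[OF H] by simp
  have "1 \<le> c * (real (nverts H) / 3)" if "c \<in> domination_exponents (path_graph 2) H" for c
    using domination_exponent_ge_nverts_ratio[OF simple_graph_path_graph _ H that]
    by (simp add: no_isolated_vertex_path_graph nverts_path_graph)
  from has_domination_exponentI[OF pos hom_density_le_powr_of_path_partition[OF H I P disj pverts_H] this]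
  show ?thesis by simp
qed

theorem domination_exponent_K2:
  assumes H: "simple_graph H" and edges_nonempty: "edges H \<noteq> {}"
  shows "has_domination_exponent K2 H (inverse (fractional_matching_number H))"
proof (rule has_domination_exponentI)
  show "0 < fractional_matching_number H"
    using fractional_matching_number_ge_1[OF H edges_nonempty] by simp
  show "1 \<le> c * fractional_matching_number H" if "c \<in> domination_exponents K2 H" for c
    using domination_exponent_ge_matching_ratio[of 1 K2, OF _ _ H that] by (simp add: hom_density_nonneg)
qed (rule hom_density_le_K2_powr_fractional_matching_number[OF H edges_nonempty])

lemma hom_density_le_subgraph:
  assumes "simple_graph H" "is_subgraph G H" "simple_graph T"
  shows "hom_density H T \<le> hom_density G T"
  using hom_density_le_powr_fractional_packing[of H T "{()}" "\<lambda>_. G" "\<lambda>_. 1" G "\<lambda>_. 1"] assms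
  by (simp add: hom_density_nonneg)

theorem domination_exponent_subgraph:
  assumes G: "simple_graph G" and H: "simple_graph H" and edges_nonempty: "edges G \<noteq> {}"
    and subgraph: "is_subgraph G H"
    and numbers_eq: "fractional_matching_number G = fractional_matching_number H"
  shows "has_domination_exponent G H 1"
proof -
  have pos: "0 < fractional_matching_number G"
    using fractional_matching_number_ge_1[OF G edges_nonempty] by simp
  have "1 \<le> c * 1" if "c \<in> domination_exponents G H" for c
    using domination_exponent_ge_matching_ratio[OF pos
        hom_density_le_K2_powr_fractional_matching_number[OF G edges_nonempty] H that] pos
    by (simp add: numbers_eq)
  then have "has_domination_exponent G H (inverse 1)"
    using hom_density_le_subgraph[OF H subgraph]
    by (intro has_domination_exponentI) (simp_all add: hom_density_nonneg)
  then show ?thesis by simp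
qed

theorem theorem5p1:
  shows
    "(\<forall>(H1 :: 'a pair_pre_digraph) (H2 :: 'b pair_pre_digraph).
        simple_graph H1 \<and> simple_graph H2 \<and> no_isolated_vertex H1 \<and> nverts H1 \<le> nverts H2 \<and>
        (\<forall>S \<subseteq> pverts H2. card S = nverts H1 \<longrightarrow> contains_copy H2 S H1)
        \<longrightarrow> has_domination_exponent H1 H2 (real (nverts H1) / real (nverts H2))) \<and>
     (\<forall>H :: 'c pair_pre_digraph.
        simple_graph H \<and>
        (\<exists>(k :: nat) (l :: nat \<Rightarrow> nat) (P :: nat \<Rightarrow> 'c pair_pre_digraph).
           (\<forall>i \<in> {1..k}. l i \<ge> 2 \<and> is_subgraph (P i) H \<and> isomorphic (path_graph (l i)) (P i)) \<and>
           disjoint_family_on (\<lambda>i. pverts (P i)) {1..k} \<and>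
           pverts H = (\<Union>i \<in> {1..k}. pverts (P i)))
        \<longrightarrow> has_domination_exponent (path_graph 2) H (3 / real (nverts H))) \<and>
     (\<forall>H :: 'd pair_pre_digraph.
        simple_graph H \<and> edges H \<noteq> {}
        \<longrightarrow> has_domination_exponent K2 H (inverse (fractional_matching_number H))) \<and>
     (\<forall>(H1 :: 'e pair_pre_digraph) (H2 :: 'e pair_pre_digraph).
        simple_graph H1 \<and> simple_graph H2 \<and> edges H1 \<noteq> {} \<and> is_subgraph H1 H2 \<and>
        fractional_matching_number H1 = fractional_matching_number H2
        \<longrightarrow> has_domination_exponent H1 H2 1)"
proof (intro conjI allI impI; elim conjE exE)
  fix H1 :: "'a pair_pre_digraph" and H2 :: "'b pair_pre_digraph"
  assume "simple_graph H1" "simple_graph H2" "no_isolated_vertex H1" "nverts H1 \<le> nverts H2"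
    "\<forall>S \<subseteq> pverts H2. card S = nverts H1 \<longrightarrow> contains_copy H2 S H1"
  then show "has_domination_exponent H1 H2 (real (nverts H1) / real (nverts H2))"
    by (intro domination_exponent_copies) auto
next
  fix H :: "'c pair_pre_digraph" and k l and P :: "nat \<Rightarrow> 'c pair_pre_digraph"
  assume "simple_graph H" "disjoint_family_on (\<lambda>i. pverts (P i)) {1..k}"
    "pverts H = (\<Union>i \<in> {1..k}. pverts (P i))"
    "\<forall>i \<in> {1..k}. l i \<ge> 2 \<and> is_subgraph (P i) H \<and> isomorphic (path_graph (l i)) (P i)"
  then show "has_domination_exponent (path_graph 2) H (3 / real (nverts H))"
    by (intro domination_exponent_path_partition[where P = P and l = l and I = "{1..k}"]) auto
qed (simp_all add: domination_exponent_K2 domination_exponent_subgraph)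

end
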